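(* Let $T$ be a non-empty tree with finitely many initial nodes, let $d$ be a pseudo-metric on $[T]$ such that $[T]$ with its tree topology is $d$-fragmentable, let $\varepsilon>0$, and let $\eta$ be the ordinal with $\mathrm{Frag}(d,[T],\varepsilon)=\eta+1$. Let $\mathcal B$ be the family of all sets of the form $U_t\setminus\bigcup_{s\in F}U_s$ with $t\in T$ and $F$ a finite (possibly empty) subset of $S_t$. Then there exists a subset $\mathcal N$ of $\mathcal B$ which is a well-founded tree under containment (i.e. under the order $M\preccurlyeq N\iff M\supseteq N$) such that $$d\text{-}\mathrm{diam}\Big(M\setminus\bigcup_{N\in S_M}N\Big)<\varepsilon$$ for each $M\in\mathcal N$, where $S_M$ denotes the set of direct successors of $M$ in the tree $(\mathcal N,\supseteq)$, and such that the ordinal index of $\mathcal N$ satisfies $\mathrm{o}(\mathcal N)\le\lambda+2n+2$, where $\eta=\lambda+n$ with $\lambda$ a limit ordinal (possibly $0$) and $n<\omega$. Moreover, $\bigcup\mathcal N=[T]$, and $\mathcal N$ has finitely many initial nodes.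
   Context: Trees. A tree is a set $T$ with a reflexive partial order $\preccurlyeq$ such that for each $t\in T$ the set $b_t=\{s\in T: s\preccurlyeq t\}$ is finite and linearly ordered. Initial nodes are the minimal elements of $T$. For non-minimal $t$, the direct predecessor of $t$ is the maximum of $b_t\setminus\{t\}$. $S_u$ denotes the set of direct successors of $u$, i.e. of those elements whose direct predecessor is $u$. A branch of $T$ is a non-empty linearly ordered subset of $T$ closed under taking direct predecessors. $[T]$ is the set of all branches. Each finite branch equals $b_t$ for a unique $t\in T$ and is identified with $t$, so that $[T]=T\cup\partial T$, where $\partial T$ is the set of infinite branches. $T$ is well-founded if $\partial T=\emptyset$. For $t\in T$ put $U_t=\{b\in[T]: t\in b\}$; the tree topology on $[T]$ is the topology generated by $\{U_t,\ [T]\setminus U_t: t\in T\}$. When $T$ has finitely many initial nodes, $[T]$ is a compact Hausdorff space. Ordinal index. For a well-founded tree $T$ and $S\subset T$ let $S'$ be the set of elements of $S$ that are not maximal in $S$. Put $T^{(0)}=T$, $T^{(\gamma+1)}=(T^{(\gamma)})'$, $T^{(\alpha)}=\bigcap_{\gamma<\alpha}T^{(\gamma)}$ for limit ordinals $\alpha$. Then $\mathrm{o}(T)=\min\{\alpha: T^{(\alpha)}=\emptyset\}$. Fragmentation. Let $K$ be a topological space with a pseudo-metric $d$ (not necessarily related to the topology). $K$ is $d$-fragmentable if for every non-empty closed $F\subset K$ and every $\varepsilon>0$ there is an open $U\subset K$ with $U\cap F\ne\emptyset$ and $d\text{-}\mathrm{diam}(U\cap F)<\varepsilon$. For closed $F\subset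 K$ and $\varepsilon>0$, $F'_\varepsilon$ is the set of $\xi\in F$ such that $d\text{-}\mathrm{diam}(U\cap F)\ge\varepsilon$ for every open neighbourhood $U$ of $\xi$. Put $F^{(0)}_\varepsilon=F$, $F^{(\gamma+1)}_\varepsilon=(F^{(\gamma)}_\varepsilon)'_\varepsilon$, $F^{(\alpha)}_\varepsilon=\bigcap_{\gamma<\alpha}F^{(\gamma)}_\varepsilon$ for limit $\alpha$. If $K$ is $d$-fragmentable, then $\mathrm{Frag}(d,F,\varepsilon)$ is the least ordinal $\beta$ with $F^{(\beta)}_\varepsilon=\emptyset$; it is a successor ordinal when $F$ is compact and non-empty. *)

theory Defs
  imports "HOL-Analysis.Analysis"
begin

unbundle cardinal_syntax

text \<open>
  HOL has no type of all ordinals. The type \<open>'k ordinal\<close> consists of the ordinals below the successor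
  cardinal of the infinite cardinal \<open>max(|'k|, \<omega>)\<close>, realised as the elements of that successor cardinal
  seen as a well-order. It contains the order type of every well-order on (a subset of) \<open>'k\<close>, see
  \<open>ordinal_exhaustive\<close> below. A decreasing sequence of subsets
  of \<open>'k\<close> indexed by \<open>'k ordinal\<close> is therefore constant from some index on.
\<close>

definition ordinal_rel :: "('k + nat) set rel" where
  "ordinal_rel = cardSuc |UNIV :: ('k + nat) set|"

lemma ordinal_rel_Card_order: "Card_order (ordinal_rel :: ('k + nat) set rel)"
  unfolding ordinal_rel_def by (rule cardSuc_Card_order[OF card_of_Card_order])

lemma ordinal_rel_Well_order: "Well_order (ordinal_rel :: ('k + nat) set rel)"
  unfolding ordinal_rel_def by (rule cardSuc_Well_order[OF card_of_Card_order])

lemma ordinal_rel_infinite: "infinite (Field (ordinal_rel :: ('k + nat) set rel))"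
proof -
  have "infinite (UNIV :: ('k + nat) set)"
    by (simp add: finite_Plus_UNIV_iff)
  then show ?thesis
    unfolding ordinal_rel_def by (simp add: cardSuc_finite[OF card_of_Card_order] Field_card_of)
qed

typedef 'k ordinal = "Field (ordinal_rel :: ('k + nat) set rel)"
  using ordinal_rel_infinite by (metis finite.emptyI ex_in_conv)

instantiation ordinal :: (type) wellorder
begin

definition less_eq_ordinal :: "'a ordinal \<Rightarrow> 'a ordinal \<Rightarrow> bool" where
  "less_eq_ordinal \<alpha> \<beta> \<longleftrightarrow> (Rep_ordinal \<alpha>, Rep_ordinal \<beta>) \<in> ordinal_rel"

definition less_ordinal :: "'a ordinal \<Rightarrow> 'a ordinal \<Rightarrow> bool" where
  "less_ordinal \<alpha> \<beta> \<longleftrightarrow> \<alpha> \<le> \<beta> \<and> \<alpha> \<noteq> \<beta>"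

instance
proof
  let ?r = "ordinal_rel :: ('a + nat) set rel"
  have wo: "wo_rel ?r" by (simp add: wo_rel_def ordinal_rel_Well_order)
  have refl: "\<And>x. x \<in> Field ?r \<Longrightarrow> (x, x) \<in> ?r"
    using wo_rel.REFL[OF wo] by (auto simp: refl_on_def)
  have antisym: "\<And>x y. (x, y) \<in> ?r \<Longrightarrow> (y, x) \<in> ?r \<Longrightarrow> x = y"
    using wo_rel.ANTISYM[OF wo] by (auto simp: antisym_def)
  have trans: "\<And>x y z. (x, y) \<in> ?r \<Longrightarrow> (y, z) \<in> ?r \<Longrightarrow> (x, z) \<in> ?r"
    using wo_rel.TRANS[OF wo] by (auto dest: transD)
  have total: "\<And>x y. x \<in> Field ?r \<Longrightarrow> y \<in> Field ?r \<Longrightarrow> (x, y) \<in> ?r \<or> (y, x) \<in> ?r"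
    using wo_rel.TOTALS[OF wo] by blast
  fix x y z :: "'a ordinal"
  show "x \<le> x" unfolding less_eq_ordinal_def by (rule refl) (rule Rep_ordinal)
  show "x \<le> y \<Longrightarrow> y \<le> z \<Longrightarrow> x \<le> z" unfolding less_eq_ordinal_def by (rule trans)
  show as: "x \<le> y \<Longrightarrow> y \<le> x \<Longrightarrow> x = y"
    unfolding less_eq_ordinal_def by (metis antisym Rep_ordinal_inject)
  show "x \<le> y \<or> y \<le> x" unfolding less_eq_ordinal_def by (rule total) (rule Rep_ordinal)+
  show "(x < y) = (x \<le> y \<and> \<not> y \<le> x)"
    unfolding less_ordinal_def less_eq_ordinal_def by (metis antisym Rep_ordinal_inject refl Rep_ordinal)
next
  let ?r = "ordinal_rel :: ('a + nat) set rel"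
  fix P :: "'a ordinal \<Rightarrow> bool" and a
  assume step: "\<And>x. (\<And>y. y < x \<Longrightarrow> P y) \<Longrightarrow> P x"
  have "wf (?r - Id)"
    using ordinal_rel_Well_order[where 'k = 'a] by (simp add: well_order_on_def)
  then have wf: "wf (inv_image (?r - Id) Rep_ordinal)" by (rule wf_inv_image)
  show "P a"
  proof (induction a rule: wf_induct_rule[OF wf])
    case (1 x)
    show ?case
      by (rule step, rule 1) (auto simp: less_ordinal_def less_eq_ordinal_def Rep_ordinal_inject)
  qed
qed

end

instance ordinal :: (type) no_top
proof
  fix x :: "'a ordinal"
  let ?r = "ordinal_rel :: ('a + nat) set rel"
  show "\<exists>y. x < y"
  proof -
    obtain b where b: "b \<in> Field ?r" "Rep_ordinal x \<noteq> b" "(Rep_ordinal x, b) \<in> ?r"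
      using infinite_Card_order_limit[OF ordinal_rel_Card_order ordinal_rel_infinite Rep_ordinal] by blast
    then have "x < Abs_ordinal b"
      unfolding less_ordinal_def less_eq_ordinal_def by (metis Abs_ordinal_inverse)
    then show ?thesis ..
  qed
qed

lemma ordinal_exhaustive:
  fixes r :: "'k rel"
  assumes "Well_order r"
  shows "\<exists>\<beta> :: 'k ordinal. r =o relation_of (\<le>) {..<\<beta>}"
proof -
  let ?s = "ordinal_rel :: ('k + nat) set rel"
  have "r <o ?s"
  proof (rule ccontr)
    assume "\<not> r <o ?s"
    then have "?s \<le>o r" using assms ordinal_rel_Well_order not_ordLess_iff_ordLeq by blast
    then have "|Field ?s| \<le>o |Field r|" by (rule card_of_mono2)
    moreover have "|Field r| \<le>o |UNIV :: ('k + nat) set|"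
      unfolding card_of_ordLeq[symmetric] by (intro exI[of _ Inl]) (auto simp: inj_on_def)
    moreover have "|UNIV :: ('k + nat) set| <o ?s"
      unfolding ordinal_rel_def by (rule cardSuc_greater[OF card_of_Card_order])
    moreover have "?s =o |Field ?s|"
      by (rule ordIso_symmetric, rule card_of_Field_ordIso, rule ordinal_rel_Card_order)
    ultimately have "?s <o ?s"
      by (meson ordLeq_ordLess_trans ordIso_ordLeq_trans)
    then show False using ordLess_irreflexive by blast
  qed
  then obtain a where a: "a \<in> Field ?s" and iso: "r =o Restr ?s (underS ?s a)"
    using ordLess_iff_ordIso_Restr[OF ordinal_rel_Well_order assms] by blast
  define \<beta> where "\<beta> = Abs_ordinal a"
  let ?q = "relation_of (\<le>) {..<\<beta>}"
  let ?p = "Restr ?s (underS ?s a)"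
  have rep: "Rep_ordinal \<beta> = a" unfolding \<beta>_def by (rule Abs_ordinal_inverse[OF a])
  have wop: "Well_order ?p" by (rule Well_order_Restr[OF ordinal_rel_Well_order])
  have us: "underS ?s a = Rep_ordinal ` {..<\<beta>}"
  proof (intro set_eqI iffI)
    fix x assume x: "x \<in> underS ?s a"
    then have "x \<in> Field ?s" by (auto simp: underS_def Field_def)
    then have "Rep_ordinal (Abs_ordinal x) = x" by (rule Abs_ordinal_inverse)
    moreover from this have "Abs_ordinal x < \<beta>"
      using x rep by (auto simp: less_ordinal_def less_eq_ordinal_def underS_def)
    ultimately show "x \<in> Rep_ordinal ` {..<\<beta>}" by (metis image_eqI lessThan_iff)
  next
    fix x assume "x \<in> Rep_ordinal ` {..<\<beta>}"
    then show "x \<in> underS ?s a"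
      using rep by (auto simp: less_ordinal_def less_eq_ordinal_def underS_def Rep_ordinal_inject)
  qed
  have "?p = dir_image ?q Rep_ordinal"
  proof (intro set_eqI iffI)
    fix z assume z: "z \<in> ?p"
    obtain u v where uv: "z = (u, v)" by (cases z)
    then have "u \<in> Rep_ordinal ` {..<\<beta>}" "v \<in> Rep_ordinal ` {..<\<beta>}" "(u, v) \<in> ?s"
      using z unfolding us by auto
    then show "z \<in> dir_image ?q Rep_ordinal"
      unfolding uv dir_image_def relation_of_def less_eq_ordinal_def by blast
  next
    fix z assume "z \<in> dir_image ?q Rep_ordinal"
    then show "z \<in> ?p"
      unfolding us dir_image_def relation_of_def less_eq_ordinal_def by auto
  qed
  moreover have "Well_order ?q"
  proof -
    have fq: "Field ?q = {..<\<beta>}" unfolding relation_of_def Field_def by auto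
    have "wf (?q - Id)"
      by (rule wf_subset[OF wf]) (auto simp: relation_of_def)
    then show ?thesis
      unfolding fq well_order_on_def linear_order_on_def partial_order_on_def preorder_on_def
      by (auto simp: relation_of_def refl_on_def trans_def antisym_def total_on_def)
  qed
  ultimately have "?q =o ?p"
    using dir_image_ordIso[of ?q Rep_ordinal] by (simp add: inj_on_def Rep_ordinal_inject)
  then show ?thesis using iso ordIso_symmetric ordIso_transitive by blast
qed

definition osucc :: "'o::{wellorder,no_top} \<Rightarrow> 'o" where
  "osucc \<alpha> = (LEAST \<beta>. \<alpha> < \<beta>)"

text \<open>Zero counts as a limit ordinal here.\<close>

definition limit_ordinal :: "'o::{wellorder,no_top} \<Rightarrow> bool" where
  "limit_ordinal \<alpha> \<longleftrightarrow> (\<nexists>\<gamma>. \<alpha> = osucc \<gamma>)"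

lemma less_osucc: "\<alpha> < osucc (\<alpha> :: 'o::{wellorder,no_top})"
  unfolding osucc_def by (rule LeastI_ex) (rule gt_ex)

lemma osucc_le_iff: "osucc \<alpha> \<le> \<beta> \<longleftrightarrow> \<alpha> < (\<beta> :: 'o::{wellorder,no_top})"
  using less_osucc[of \<alpha>] unfolding osucc_def by (meson Least_le order_less_le_trans)

lemma osucc_inject: "osucc \<alpha> = osucc \<beta> \<longleftrightarrow> \<alpha> = (\<beta> :: 'o::{wellorder,no_top})"
  by (metis less_osucc osucc_le_iff linorder_neqE not_le)

function iter_deriv :: "('s set \<Rightarrow> 's set) \<Rightarrow> 's set \<Rightarrow> 'o::{wellorder,no_top} \<Rightarrow> 's set" where
  "iter_deriv D A \<alpha> =
    (if \<forall>\<gamma>. \<alpha> \<le> \<gamma> then A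
     else if \<exists>\<gamma>. \<alpha> = osucc \<gamma> then D (iter_deriv D A (THE \<gamma>. \<alpha> = osucc \<gamma>))
     else \<Inter>\<gamma>\<in>{..<\<alpha>}. iter_deriv D A \<gamma>)"
  by pat_completeness auto
termination
proof (relation "inv_image {(x, y). x < y} (\<lambda>(D, A, \<alpha>). \<alpha>)")
  show "wf (inv_image {(x :: 'o::{wellorder,no_top}, y). x < y} (\<lambda>(D :: 's set \<Rightarrow> 's set, A :: 's set, \<alpha>). \<alpha>))"
    by (rule wf_inv_image) (rule wf)
qed (auto simp: osucc_inject less_osucc)

declare iter_deriv.simps[simp del]

lemma iter_deriv_zero: "(\<And>\<gamma>. \<alpha> \<le> \<gamma>) \<Longrightarrow> iter_deriv D A \<alpha> = A"
  by (subst iter_deriv.simps) simp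

lemma iter_deriv_osucc: "iter_deriv D A (osucc \<gamma>) = D (iter_deriv D A \<gamma>)"
  by (subst iter_deriv.simps) (auto simp: osucc_inject osucc_le_iff)

lemma iter_deriv_limit:
  "limit_ordinal \<alpha> \<Longrightarrow> \<beta> < \<alpha> \<Longrightarrow> iter_deriv D A \<alpha> = (\<Inter>\<gamma>\<in>{..<\<alpha>}. iter_deriv D A \<gamma>)"
  by (subst iter_deriv.simps) (simp add: limit_ordinal_def, meson not_le)

text \<open>A tree is given by its carrier \<open>T\<close> and its reflexive order \<open>r \<subseteq> T \<times> T\<close>; \<open>b\<^sub>t\<close> is \<open>under r t\<close>.\<close>

definition tree :: "'t set \<Rightarrow> 't rel \<Rightarrow> bool" where
  "tree T r \<longleftrightarrow> partial_order_on T r \<and> (\<forall>t\<in>T. finite (under r t) \<and> under r t \<in> Chains r)"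

definition initial_nodes :: "'t set \<Rightarrow> 't rel \<Rightarrow> 't set" where
  "initial_nodes T r = {t \<in> T. \<forall>s\<in>T. (s, t) \<in> r \<longrightarrow> s = t}"

definition direct_pred :: "'t rel \<Rightarrow> 't \<Rightarrow> 't \<Rightarrow> bool" where
  "direct_pred r u t \<longleftrightarrow> u \<in> under r t - {t} \<and> (\<forall>s \<in> under r t - {t}. (s, u) \<in> r)"

definition direct_succs :: "'t set \<Rightarrow> 't rel \<Rightarrow> 't \<Rightarrow> 't set" where
  "direct_succs T r u = {t \<in> T. direct_pred r u t}"

definition branches :: "'t set \<Rightarrow> 't rel \<Rightarrow> 't set set" where
  "branches T r = {b. b \<noteq> {} \<and> b \<subseteq> T \<and> b \<in> Chains r \<and>
     (\<forall>t\<in>b. \<forall>u. direct_pred r u t \<longrightarrow> u \<in> b)}"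

definition well_founded_tree :: "'t set \<Rightarrow> 't rel \<Rightarrow> bool" where
  "well_founded_tree T r \<longleftrightarrow> tree T r \<and> (\<nexists>b. b \<in> branches T r \<and> infinite b)"

definition branches_through :: "'t set \<Rightarrow> 't rel \<Rightarrow> 't \<Rightarrow> 't set set" where
  "branches_through T r t = {b \<in> branches T r. t \<in> b}"

definition tree_topology :: "'t set \<Rightarrow> 't rel \<Rightarrow> 't set topology" where
  "tree_topology T r = topology_generated_by
     (\<Union>t\<in>T. {branches_through T r t, branches T r - branches_through T r t})"

definition non_maximal :: "'t rel \<Rightarrow> 't set \<Rightarrow> 't set" where
  "non_maximal r S = {s \<in> S. \<exists>u\<in>S. (s, u) \<in> r \<and> u \<noteq> s}"

text \<open>
  The type \<open>'k ordinal\<close> has to be large enough for the minimum to exist; \<open>'k = 't\<close> and anything of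
  larger cardinality is, for well-founded trees.
\<close>

definition ordinal_index :: "'t set \<Rightarrow> 't rel \<Rightarrow> 'k ordinal" where
  "ordinal_index T r = (LEAST \<alpha>. iter_deriv (non_maximal r) T \<alpha> = {})"

definition containment_order :: "'p set set \<Rightarrow> 'p set rel" where
  "containment_order \<N> = {(M, N). M \<in> \<N> \<and> N \<in> \<N> \<and> M \<supseteq> N}"

definition basic_clopens :: "'t set \<Rightarrow> 't rel \<Rightarrow> 't set set set" where
  "basic_clopens T r = {branches_through T r t - (\<Union>s\<in>F. branches_through T r s) | t F.
     t \<in> T \<and> F \<subseteq> direct_succs T r t \<and> finite F}"

definition pseudo_metric_on :: "'p set \<Rightarrow> ('p \<Rightarrow> 'p \<Rightarrow> real) \<Rightarrow> bool" where
  "pseudo_metric_on K d \<longleftrightarrow>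
     (\<forall>x\<in>K. \<forall>y\<in>K. 0 \<le> d x y \<and> d x y = d y x) \<and> (\<forall>x\<in>K. d x x = 0) \<and>
     (\<forall>x\<in>K. \<forall>y\<in>K. \<forall>z\<in>K. d x z \<le> d x y + d y z)"

text \<open>The diameter of an unbounded set is infinite, that of the empty set is zero.\<close>

definition d_diam :: "('p \<Rightarrow> 'p \<Rightarrow> real) \<Rightarrow> 'p set \<Rightarrow> ennreal" where
  "d_diam d A = (SUP x\<in>A. SUP y\<in>A. ennreal (d x y))"

definition fragmentable :: "'p topology \<Rightarrow> ('p \<Rightarrow> 'p \<Rightarrow> real) \<Rightarrow> bool" where
  "fragmentable X d \<longleftrightarrow> (\<forall>F \<epsilon>. closedin X F \<and> F \<noteq> {} \<and> 0 < \<epsilon> \<longrightarrow>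
     (\<exists>U. openin X U \<and> U \<inter> F \<noteq> {} \<and> d_diam d (U \<inter> F) < ennreal \<epsilon>))"

definition frag_deriv :: "'p topology \<Rightarrow> ('p \<Rightarrow> 'p \<Rightarrow> real) \<Rightarrow> real \<Rightarrow> 'p set \<Rightarrow> 'p set" where
  "frag_deriv X d \<epsilon> F =
     {\<xi> \<in> F. \<forall>U. openin X U \<and> \<xi> \<in> U \<longrightarrow> ennreal \<epsilon> \<le> d_diam d (U \<inter> F)}"

text \<open>Here, too, \<open>'k = 'p\<close> or anything of larger cardinality is large enough if \<open>X\<close> is \<open>d\<close>-fragmentable,
  \<open>F\<close> is closed and \<open>\<epsilon> > 0\<close>.\<close>

definition Frag :: "'p topology \<Rightarrow> ('p \<Rightarrow> 'p \<Rightarrow> real) \<Rightarrow> 'p set \<Rightarrow> real \<Rightarrow> 'k ordinal" where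
  "Frag X d F \<epsilon> = (LEAST \<beta>. iter_deriv (frag_deriv X d \<epsilon>) F \<beta> = {})"

end

theory Submission
  imports Defs
begin

text \<open>
  For an ordinal \<open>\<gamma>\<close> let \<open>Q \<gamma>\<close> be the \<open>\<gamma>\<close>-th \<open>\<epsilon>\<close>-derivative of \<open>[T]\<close>. Call \<open>V \<in> \<B>\<close> good if, for some \<open>\<gamma>\<close>,
  it meets \<open>Q \<gamma>\<close> in a set of diameter less than \<open>\<epsilon>\<close> and misses \<open>Q (\<gamma> + 1)\<close>; let \<open>f V\<close> be this \<open>\<gamma>\<close>, so
  that \<open>f V \<le> \<eta>\<close>. Every point has arbitrarily small good neighbourhoods. Choosing one set \<open>U\<^sub>t - (\<Union>s\<in>F. U\<^sub>s)\<close>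
  for each node \<open>t\<close> always gives a laminar family, and its maximal members are pairwise disjoint; hence
  every open set is a disjoint union of good sets. Starting from such a partition of \<open>[T]\<close>, which is
  finite by compactness, partition \<open>V - Q (f V)\<close> in turn for every \<open>V\<close> obtained so far. The index
  \<open>f\<close> drops from \<open>V\<close> to its successors, so the resulting tree is well-founded and its ordinal index is
  at most \<open>\<eta> + 1\<close>, which is better than the bound \<open>\<lambda> + 2n + 2\<close>.
\<close>

section \<open>Ordinals and iterated derivatives\<close>

lemma ordinal_cases [case_names zero succ limit]:
  fixes \<alpha> :: "'o::{wellorder,no_top}"
  obtains "\<And>\<gamma>. \<alpha> \<le> \<gamma>" | \<gamma> where "\<alpha> = osucc \<gamma>" | \<gamma> where "limit_ordinal \<alpha>" "\<gamma> < \<alpha>"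
  unfolding limit_ordinal_def by (meson not_le)

lemma funpow_osucc_mono:
  "m \<le> n \<Longrightarrow> (osucc ^^ m) \<alpha> \<le> (osucc ^^ n) (\<alpha> :: 'o::{wellorder,no_top})"
  by (rule lift_Suc_mono_le) (auto intro: less_imp_le less_osucc)

lemma osucc_less_limit:
  "limit_ordinal \<alpha> \<Longrightarrow> \<beta> < \<alpha> \<Longrightarrow> osucc \<beta> < (\<alpha> :: 'o::{wellorder,no_top})"
  unfolding limit_ordinal_def by (metis order_le_less osucc_le_iff)

text \<open>Counting: \<open>'k ordinal\<close> has the size of the successor cardinal of
  \<open>'k + nat\<close>, and an injection into \<open>'k\<close> would put that cardinal strictly
  below itself.\<close>

lemma not_inj_ordinal:
  fixes g :: "'k ordinal \<Rightarrow> 'k"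
  shows "\<not> inj g"
proof
  assume "inj g"
  then have "|UNIV :: 'k ordinal set| \<le>o |UNIV :: ('k + nat) set|"
    unfolding card_of_ordLeq[symmetric]
    by (intro exI[of _ "Inl \<circ> g"]) (auto simp: inj_on_def)
  moreover have "|Field (ordinal_rel :: ('k + nat) set rel)| \<le>o |UNIV :: 'k ordinal set|"
    unfolding card_of_ordLeq[symmetric]
    by (intro exI[of _ Abs_ordinal]) (auto simp: inj_on_def Abs_ordinal_inject)
  moreover have "(ordinal_rel :: ('k + nat) set rel) =o |Field (ordinal_rel :: ('k + nat) set rel)|"
    by (rule ordIso_symmetric, rule card_of_Field_ordIso, rule ordinal_rel_Card_order)
  moreover have "|UNIV :: ('k + nat) set| <o (ordinal_rel :: ('k + nat) set rel)"
    unfolding ordinal_rel_def by (rule cardSuc_greater[OF card_of_Card_order])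
  ultimately have "(ordinal_rel :: ('k + nat) set rel) <o (ordinal_rel :: ('k + nat) set rel)"
    by (meson ordIso_ordLeq_trans ordLeq_ordLess_trans ordLeq_transitive)
  then show False
    using ordLess_irreflexive by blast
qed

lemma iter_deriv_antimono:
  fixes \<alpha> :: "'o::{wellorder,no_top}"
  assumes "\<And>B. D B \<subseteq> B"
  shows "\<alpha> \<le> \<beta> \<Longrightarrow> iter_deriv D A \<beta> \<subseteq> iter_deriv D A \<alpha>"
proof (induction \<beta> rule: less_induct)
  case (less \<beta>)
  show ?case
  proof (cases "\<alpha> = \<beta>")
    case False
    then have lt: "\<alpha> < \<beta>" using less.prems by simp
    show ?thesis
    proof (cases \<beta> rule: ordinal_cases)
      case zero
      then show ?thesis using lt leD by blast
    next
      case (succ \<gamma>)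
      then have "\<alpha> \<le> \<gamma>"
        using lt by (metis not_le osucc_le_iff)
      then have "iter_deriv D A \<gamma> \<subseteq> iter_deriv D A \<alpha>"
        using less.IH succ less_osucc by blast
      then show ?thesis
        unfolding succ iter_deriv_osucc using assms by (rule order_trans[rotated])
    next
      case (limit \<gamma>)
      show ?thesis
        unfolding iter_deriv_limit[OF limit] using lt by blast
    qed
  qed simp
qed

lemma iter_deriv_subset:
  fixes \<alpha> :: "'o::{wellorder,no_top}"
  assumes "\<And>B. D B \<subseteq> B"
  shows "iter_deriv D A \<alpha> \<subseteq> A"
proof -
  \<comment> \<open>\<open>z\<close> is the ordinal zero, the stage at which nothing has been
    removed yet.\<close>
  define z :: 'o where "z = (LEAST z. True)"
  have z: "z \<le> \<delta>" for \<delta> unfolding z_def by (rule Least_le) simp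
  show ?thesis
    using iter_deriv_antimono[OF assms z, where A = A] unfolding iter_deriv_zero[OF z] .
qed

text \<open>The first stage that misses \<open>x\<close> is not zero, and not a limit because a
  limit stage is the intersection of the earlier ones; so it is a successor.\<close>

lemma iter_deriv_last_stage:
  fixes \<beta> :: "'o::{wellorder,no_top}"
  assumes "x \<in> A" and "x \<notin> iter_deriv D A \<beta>"
  obtains \<gamma> :: 'o where "x \<in> iter_deriv D A \<gamma>" "x \<notin> iter_deriv D A (osucc \<gamma>)"
proof -
  define \<alpha> where "\<alpha> = (LEAST \<alpha>. x \<notin> iter_deriv D A (\<alpha> :: 'o))"
  have out: "x \<notin> iter_deriv D A \<alpha>"
    unfolding \<alpha>_def by (rule LeastI[of "\<lambda>\<alpha>. x \<notin> iter_deriv D A \<alpha>", OF assms(2)])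
  have inside: "x \<in> iter_deriv D A \<gamma>" if "\<gamma> < \<alpha>" for \<gamma>
    using not_less_Least[OF that[unfolded \<alpha>_def]] by simp
  show thesis
  proof (cases \<alpha> rule: ordinal_cases)
    case zero
    show thesis
      using out assms(1) unfolding iter_deriv_zero[OF zero] by simp
  next
    case (succ \<gamma>)
    then show thesis
      using out inside[of \<gamma>] that[of \<gamma>] less_osucc[of \<gamma>] by simp
  next
    case (limit \<gamma>)
    then show thesis
      using out inside unfolding iter_deriv_limit[OF limit] by blast
  qed
qed

lemma non_maximal_subset: "non_maximal r S \<subseteq> S"
  unfolding non_maximal_def by blast

lemma non_maximalD: "s \<in> non_maximal r S \<Longrightarrow> s \<in> S \<and> (\<exists>u\<in>S. (s, u) \<in> r \<and> u \<noteq> s)"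
  unfolding non_maximal_def by blast

text \<open>A function that drops along strict steps of \<open>r\<close> bounds how long an element
  survives: to survive stage \<open>osucc \<gamma>\<close>, \<open>x\<close> needs some
  \<open>u\<close> strictly above it in stage \<open>\<gamma>\<close>, whence
  \<open>\<gamma> \<le> f u < f x\<close>.\<close>

lemma iter_deriv_non_maximal_le:
  fixes f :: "'s \<Rightarrow> 'o::{wellorder,no_top}"
  assumes "\<And>x y. x \<in> A \<Longrightarrow> y \<in> A \<Longrightarrow> (x, y) \<in> r \<Longrightarrow> y \<noteq> x \<Longrightarrow> f y < f x"
  shows "x \<in> iter_deriv (non_maximal r) A \<alpha> \<Longrightarrow> \<alpha> \<le> f x"
proof (induction \<alpha> arbitrary: x rule: less_induct)
  case (less \<alpha>)
  have sub: "iter_deriv (non_maximal r) A \<gamma> \<subseteq> A" for \<gamma> :: 'o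
    by (rule iter_deriv_subset[OF non_maximal_subset])
  show ?case
  proof (cases \<alpha> rule: ordinal_cases)
    case (succ \<gamma>)
    then obtain u where "x \<in> iter_deriv (non_maximal r) A \<gamma>" "u \<in> iter_deriv (non_maximal r) A \<gamma>"
        "(x, u) \<in> r" "u \<noteq> x"
      using non_maximalD[OF less.prems[unfolded succ iter_deriv_osucc]] by blast
    moreover from this(2) have "\<gamma> \<le> f u"
      using less.IH less_osucc[of \<gamma>] unfolding succ by blast
    moreover have "f u < f x"
      using calculation(1-4) assms sub by blast
    ultimately show ?thesis
      unfolding succ osucc_le_iff by order
  next
    case (limit \<gamma>)
    \<comment> \<open>Otherwise \<open>osucc (f x)\<close> is still below the limit and
      \<open>x\<close> survives that earlier stage, against the induction hypothesis.\<close>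
    have "\<not> f x < \<alpha>"
    proof
      assume "f x < \<alpha>"
      then have lt: "osucc (f x) < \<alpha>" using limit osucc_less_limit by blast
      then have "x \<in> iter_deriv (non_maximal r) A (osucc (f x))"
        using less.prems unfolding iter_deriv_limit[OF limit] by blast
      then show False
        using less.IH[OF lt] less_osucc leD by blast
    qed
    then show ?thesis by simp
  qed simp
qed

section \<open>Fragmentation derivatives: closedness and termination\<close>

lemma d_diam_mono: "A \<subseteq> B \<Longrightarrow> d_diam d A \<le> d_diam d B"
  unfolding d_diam_def by (meson SUP_subset_mono order_refl)

lemma frag_deriv_subset: "frag_deriv X d \<epsilon> F \<subseteq> F"
  unfolding frag_deriv_def by blast

lemma frag_derivD:
  "\<xi> \<in> frag_deriv X d \<epsilon> F \<Longrightarrow> openin X U \<Longrightarrow> \<xi> \<in> U \<Longrightarrow> ennreal \<epsilon> \<le> d_diam d (U \<inter> F)"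
  unfolding frag_deriv_def by blast

text \<open>The discarded points are those covered by open sets with small trace on
  \<open>F\<close>, so an open set is removed from a closed one.\<close>

lemma closedin_frag_deriv:
  assumes "closedin X F"
  shows "closedin X (frag_deriv X d \<epsilon> F)"
proof -
  have "frag_deriv X d \<epsilon> F = F - \<Union>{U. openin X U \<and> \<not> ennreal \<epsilon> \<le> d_diam d (U \<inter> F)}"
    unfolding frag_deriv_def by blast
  then show ?thesis
    using assms by (metis (no_types, lifting) closedin_diff mem_Collect_eq openin_Union)
qed

lemma closedin_iter_deriv:
  fixes \<alpha> :: "'o::{wellorder,no_top}"
  assumes "\<And>B. closedin X B \<Longrightarrow> closedin X (D B)" and "closedin X A"
  shows "closedin X (iter_deriv D A \<alpha>)"
proof (induction \<alpha> rule: less_induct)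
  case (less \<alpha>)
  show ?case
  proof (cases \<alpha> rule: ordinal_cases)
    case zero
    show ?thesis using assms(2) unfolding iter_deriv_zero[OF zero] .
  next
    case (succ \<gamma>)
    then show ?thesis using less.IH[of \<gamma>] assms(1) less_osucc[of \<gamma>] by (simp add: iter_deriv_osucc)
  next
    case (limit \<gamma>)
    then have "{..<\<alpha>} \<noteq> {}" by blast
    then show ?thesis
      unfolding iter_deriv_limit[OF limit] using less.IH by (intro closedin_INT) auto
  qed
qed

text \<open>Guarantees that the \<open>LEAST\<close> in \<open>Frag\<close> is attained. If no stage
  were empty, fragmentability would make every stage lose a point; these points are distinct, which
  injects all of \<open>'k ordinal\<close> into \<open>'p\<close> and, through \<open>h\<close>,
  into \<open>'k\<close>.\<close>

lemma iter_frag_deriv_empty: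
  fixes A :: "'p set" and h :: "'p \<Rightarrow> 'k"
  assumes "fragmentable X d" and "closedin X A" and "0 < \<epsilon>" and "inj h"
  shows "\<exists>\<beta> :: 'k ordinal. iter_deriv (frag_deriv X d \<epsilon>) A \<beta> = {}"
proof (rule ccontr)
  let ?A = "iter_deriv (frag_deriv X d \<epsilon>) A :: 'k ordinal \<Rightarrow> 'p set"
  assume nonempty: "\<nexists>\<beta>. ?A \<beta> = {}"
  have "\<exists>x. x \<in> ?A \<beta> \<and> x \<notin> ?A (osucc \<beta>)" for \<beta>
  proof -
    have "closedin X (?A \<beta>)"
      using assms(2) by (intro closedin_iter_deriv closedin_frag_deriv)
    then have "\<exists>U. openin X U \<and> U \<inter> ?A \<beta> \<noteq> {} \<and> d_diam d (U \<inter> ?A \<beta>) < ennreal \<epsilon>"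
      using assms(1,3) nonempty by (simp add: fragmentable_def)
    then obtain U where U: "openin X U" "U \<inter> ?A \<beta> \<noteq> {}"
        "d_diam d (U \<inter> ?A \<beta>) < ennreal \<epsilon>"
      by (elim exE conjE)
    from U(2) obtain x where x: "x \<in> U" "x \<in> ?A \<beta>"
      by (meson disjoint_iff)
    then have "x \<notin> frag_deriv X d \<epsilon> (?A \<beta>)"
      using frag_derivD[OF _ U(1)] U(3) by (meson leD)
    then show ?thesis
      using x(2) by (auto simp: iter_deriv_osucc)
  qed
  then obtain g where g: "\<And>\<beta>. g \<beta> \<in> ?A \<beta> \<and> g \<beta> \<notin> ?A (osucc \<beta>)" by metis
  \<comment> \<open>A point chosen at a later stage lies in \<open>?A (osucc \<alpha>)\<close>,
    which excludes \<open>g \<alpha>\<close>.\<close>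
  have "g \<alpha> \<noteq> g \<beta>" if "\<alpha> < \<beta>" for \<alpha> \<beta>
  proof -
    have "?A \<beta> \<subseteq> ?A (osucc \<alpha>)"
      using that by (intro iter_deriv_antimono frag_deriv_subset) (simp add: osucc_le_iff)
    then show ?thesis using g by (metis subsetD)
  qed
  then have "inj g" by (metis injI linorder_neqE)
  then show False
    using not_inj_ordinal[of "h \<circ> g"] assms(4) by (simp add: inj_compose)
qed

section \<open>Trees of sets obtained by iterated partition\<close>

text \<open>The combinatorics of iterated partition, free of topology: \<open>G\<close> is the stock
  of admissible sets, \<open>A\<close> the first partition, \<open>c V\<close> the disjoint family
  that refines \<open>V\<close>, and \<open>f\<close> an ordinal rank. The strict drop of
  \<open>f\<close> forces each child to be a proper subset.\<close>

locale refinement =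
  fixes G :: "'p set set" and A :: "'p set set" and c :: "'p set \<Rightarrow> 'p set set"
    and f :: "'p set \<Rightarrow> 'o::wellorder"
  assumes nonempty: "V \<in> G \<Longrightarrow> V \<noteq> {}"
    and roots: "A \<subseteq> G" "pairwise disjnt A"
    and children: "V \<in> G \<Longrightarrow> c V \<subseteq> G" "V \<in> G \<Longrightarrow> pairwise disjnt (c V)"
    and step_subset: "V \<in> G \<Longrightarrow> W \<in> c V \<Longrightarrow> W \<subseteq> V"
    and step_less: "V \<in> G \<Longrightarrow> W \<in> c V \<Longrightarrow> f W < f V"
begin

definition desc :: "'p set rel" where
  "desc = {(V, W). V \<in> G \<and> W \<in> c V}\<^sup>*"

definition N :: "'p set set" where
  "N = desc `` A"

lemma desc_refl: "(V, V) \<in> desc"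
  unfolding desc_def by simp

lemma desc_trans: "(U, V) \<in> desc \<Longrightarrow> (V, W) \<in> desc \<Longrightarrow> (U, W) \<in> desc"
  unfolding desc_def by simp

lemma desc_step: "V \<in> G \<Longrightarrow> W \<in> c V \<Longrightarrow> (V, W) \<in> desc"
  unfolding desc_def by blast

lemma descD:
  assumes "(V, W) \<in> desc" and "V \<in> G"
  shows "W \<in> G \<and> W \<subseteq> V \<and> (W = V \<or> f W < f V)"
  using assms(1) unfolding desc_def
proof (induction rule: rtrancl_induct)
  case base
  then show ?case using assms(2) by simp
next
  case (step W W')
  then have W: "W \<in> G" "W' \<in> c W"
    by auto
  then have "W' \<in> G" "W' \<subseteq> W" "f W' < f W"
    using children(1)[OF W(1)] step_subset[OF W] step_less[OF W] by auto
  then show ?case using step.IH by auto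
qed

lemma desc_cases:
  assumes "(V, M) \<in> desc"
  obtains "M = V" | W where "W \<in> c V" "(W, M) \<in> desc"
  using assms unfolding desc_def by (erule_tac converse_rtranclE) blast+

lemma N_G: "N \<subseteq> G"
  unfolding N_def using roots descD by blast

lemma N_not_disjnt: "V \<in> N \<Longrightarrow> V \<subseteq> M \<Longrightarrow> V \<subseteq> M' \<Longrightarrow> \<not> disjnt M M'"
  using N_G nonempty[of V] unfolding disjnt_def by blast

lemma A_N: "A \<subseteq> N"
  unfolding N_def using desc_refl by blast

lemma step_N: "V \<in> N \<Longrightarrow> W \<in> c V \<Longrightarrow> W \<in> N"
  unfolding N_def using desc_trans desc_step N_G[unfolded N_def] by blast

lemma N_induct [consumes 1, case_names initial step]:
  assumes "V \<in> N"
    and "\<And>V. V \<in> A \<Longrightarrow> P V"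
    and "\<And>V W. V \<in> N \<Longrightarrow> P V \<Longrightarrow> W \<in> c V \<Longrightarrow> P W"
  shows "P V"
proof -
  obtain U where U: "U \<in> A" "(U, V) \<in> desc"
    using assms(1) unfolding N_def by blast
  from U(2) have "V \<in> N \<and> P V"
    unfolding desc_def
  proof (induction rule: rtrancl_induct)
    case base
    then show ?case using U(1) A_N assms(2) by blast
  next
    case (step V W)
    then have "V \<in> N" "P V" "W \<in> c V"
      by auto
    then show ?case using step_N assms(3) by blast
  qed
  then show ?thesis ..
qed

section \<open>Containment agrees with descent\<close>

text \<open>Induction over the generation of \<open>V\<close> with \<open>M\<close> fixed. Unless
  one line of ancestors continues the other, the two lines part at distinct members of one disjoint
  family, and these separate \<open>M\<close> from \<open>V\<close>.\<close>

lemma N_trichotomy: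
  assumes "V \<in> N" and "M \<in> N"
  shows "disjnt M V \<or> (M, V) \<in> desc \<or> (V, M) \<in> desc"
  using assms(1)
proof (induction rule: N_induct)
  case (initial V)
  obtain U where U: "U \<in> A" "(U, M) \<in> desc"
    using assms(2) unfolding N_def by blast
  show ?case
  proof (cases "U = V")
    case False
    then have "disjnt U V"
      using U(1) initial roots(2) by (auto simp: pairwise_def)
    moreover have "M \<subseteq> U" using U descD[of U M] roots(1) by blast
    ultimately show ?thesis by (auto simp: disjnt_def)
  qed (use U in simp)
next
  case (step V W)
  have VG: "V \<in> G" using step.hyps N_G by blast
  have WV: "W \<subseteq> V" "(V, W) \<in> desc" using VG step.hyps step_subset desc_step by auto
  consider "disjnt M V" | "(M, V) \<in> desc" | "(V, M) \<in> desc"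
    using step.IH by blast
  then show ?case
  proof cases
    case 1
    then show ?thesis using WV by (auto simp: disjnt_def)
  next
    case 2
    then show ?thesis using WV desc_trans by blast
  next
    case 3
    then show ?thesis
    proof (cases rule: desc_cases)
      case 1
      then show ?thesis using WV by simp
    next
      case (2 W')
      show ?thesis
      proof (cases "W' = W")
        case False
        then have "disjnt W' W"
          using 2 step.hyps children(2)[OF VG] by (auto simp: pairwise_def)
        moreover have "M \<subseteq> W'"
          using 2 descD[of W' M] children(1)[OF VG] by blast
        ultimately show ?thesis by (auto simp: disjnt_def)
      qed (use 2 in simp)
    qed
  qed
qed

text \<open>Nonempty sets cannot be both nested and disjoint, so \<open>N_trichotomy\<close> leaves
  only descent. The order by containment is thereby the order of generation.\<close>

lemma desc_iff_subset:
  assumes "V \<in> N" and "M \<in> N"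
  shows "(V, M) \<in> desc \<longleftrightarrow> M \<subseteq> V"
proof
  assume sub: "M \<subseteq> V"
  have "\<not> disjnt V M"
    using sub N_not_disjnt[OF assms(2)] by blast
  then consider "(V, M) \<in> desc" | "(M, V) \<in> desc"
    using N_trichotomy[OF assms(2,1)] by blast
  then show "(V, M) \<in> desc"
  proof cases
    case 2
    then have "V = M" using sub descD[of M V] N_G assms(2) by blast
    then show ?thesis by (simp add: desc_refl)
  qed
next
  assume "(V, M) \<in> desc"
  then show "M \<subseteq> V"
    using descD[of V M] N_G assms(1) by blast
qed

lemma f_less: "V \<in> N \<Longrightarrow> M \<in> N \<Longrightarrow> M \<subset> V \<Longrightarrow> f M < f V"
  using desc_iff_subset[of V M] descD[of V M] N_G by (auto simp: psubset_eq)

text \<open>Makes \<open>V\<close> the direct predecessor of its child \<open>W\<close>. As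
  \<open>M\<close> meets \<open>V\<close>, the two are comparable; if \<open>M\<close> were a proper
  descendant of \<open>V\<close>, it would lie inside a child, by disjointness inside
  \<open>W\<close> itself.\<close>

lemma supersets_step:
  assumes "V \<in> N" and "W \<in> c V" and "M \<in> N" and "W \<subset> M"
  shows "V \<subseteq> M"
proof -
  have VG: "V \<in> G" using assms(1) N_G by blast
  have W: "W \<in> G" "W \<subseteq> V" using children(1)[OF VG] step_subset[OF VG] assms(2) by auto
  have "\<not> disjnt M V"
    using W assms(4) nonempty[OF W(1)] by (auto simp: disjnt_def)
  then consider "(M, V) \<in> desc" | "(V, M) \<in> desc"
    using N_trichotomy[OF assms(1,3)] by blast
  then show ?thesis
  proof cases
    case 1
    then show ?thesis using descD[of M V] N_G assms(3) by blast
  next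
    case 2
    then show ?thesis
    proof (cases rule: desc_cases)
      case (2 W')
      have "M \<subseteq> W'" using 2 descD[of W' M] children(1)[OF VG] by blast
      moreover have "W' = W"
      proof (rule ccontr)
        assume "W' \<noteq> W"
        then have "disjnt W' W"
          using 2 assms(2) children(2)[OF VG] by (auto simp: pairwise_def)
        then show False using \<open>M \<subseteq> W'\<close> assms(4) nonempty[OF W(1)] by (auto simp: disjnt_def)
      qed
      ultimately show ?thesis using assms(4) by blast
    qed simp
  qed
qed

section \<open>The tree of members under containment\<close>

lemma under_containment_order: "V \<in> N \<Longrightarrow> under (containment_order N) V = {M \<in> N. V \<subseteq> M}"
  unfolding under_def containment_order_def by blast

lemma finite_under_N: "V \<in> N \<Longrightarrow> finite {M \<in> N. V \<subseteq> M}"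
proof (induction rule: N_induct)
  case (initial V)
  have "M = V" if M: "M \<in> N" "V \<subseteq> M" for M
  proof -
    obtain U where U: "U \<in> A" "(U, M) \<in> desc"
      using M unfolding N_def by blast
    have "M \<subseteq> U" using U descD[of U M] roots(1) by blast
    then have "\<not> disjnt U V"
      using M initial A_N by (intro N_not_disjnt[of V]) auto
    then have "U = V"
      using U initial roots(2) by (auto simp: pairwise_def)
    then show ?thesis using M \<open>M \<subseteq> U\<close> by blast
  qed
  then have "{M \<in> N. V \<subseteq> M} \<subseteq> {V}" by blast
  then show ?case by (rule finite_subset) simp
next
  case (step V W)
  \<comment> \<open>Passing to a child adds at most one superset, the child itself.\<close>
  have "{M \<in> N. W \<subseteq> M} \<subseteq> insert W {M \<in> N. V \<subseteq> M}"
    using supersets_step[OF step.hyps] by (auto simp: psubset_eq)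
  then show ?case using step.IH by (rule finite_subset[OF _ finite.insertI])
qed

lemma N_comparable:
  assumes "V \<in> N" "M \<in> N" "M' \<in> N" "V \<subseteq> M" "V \<subseteq> M'"
  shows "M \<subseteq> M' \<or> M' \<subseteq> M"
proof -
  have "\<not> disjnt M M'"
    using assms N_not_disjnt by blast
  then show ?thesis
    using N_trichotomy[OF assms(3,2)] desc_iff_subset assms(2,3) by blast
qed

lemma tree_N: "tree N (containment_order N)"
  unfolding tree_def
proof (intro conjI ballI)
  show "partial_order_on N (containment_order N)"
    unfolding partial_order_on_def preorder_on_def containment_order_def
    by (auto simp: refl_on_def trans_def antisym_def)
  fix V assume V: "V \<in> N"
  show "finite (under (containment_order N) V)"
    using finite_under_N[OF V] by (simp add: under_containment_order[OF V])
  show "under (containment_order N) V \<in> Chains (containment_order N)"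
    unfolding under_containment_order[OF V] using N_comparable[OF V]
    by (auto simp: Chains_def containment_order_def)
qed

lemma well_founded_tree_N: "well_founded_tree N (containment_order N)"
  unfolding well_founded_tree_def
proof (intro conjI tree_N notI)
  assume "\<exists>b. b \<in> branches N (containment_order N) \<and> infinite b"
  then obtain b where b: "b \<noteq> {}" "b \<subseteq> N" "b \<in> Chains (containment_order N)" "infinite b"
    unfolding branches_def by blast
  \<comment> \<open>A member of least rank is contained in every other member of the branch, so the
    branch consists of supersets of one set and is finite.\<close>
  define m where "m = (LEAST m. m \<in> f ` b)"
  have "m \<in> f ` b" unfolding m_def using b(1) by (meson LeastI_ex image_is_empty ex_in_conv)
  then obtain V where V: "V \<in> b" "f V = m" by blast
  have "V \<subseteq> M" if M: "M \<in> b" for M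
  proof (rule ccontr)
    assume "\<not> V \<subseteq> M"
    then have "M \<subset> V"
      using b(3) V M unfolding Chains_def containment_order_def by blast
    then have "f M < m" using f_less[of V M] V M b(2) by blast
    then show False using M not_less_Least unfolding m_def by blast
  qed
  then have "b \<subseteq> {M \<in> N. V \<subseteq> M}" using b(2) by blast
  then show False using finite_under_N V b finite_subset by blast
qed

text \<open>The direction that the diameter estimate uses: what the direct successors leave of
  \<open>V\<close> is contained in what the sets of \<open>c V\<close> leave.\<close>

lemma direct_succs_N:
  assumes "V \<in> N"
  shows "c V \<subseteq> direct_succs N (containment_order N) V"
proof
  fix W assume W: "W \<in> c V"
  have WN: "W \<in> N" using step_N assms W by blast
  have VG: "V \<in> G" using assms N_G by blast
  have "W \<subset> V" using VG W step_subset step_less by fastforce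
  then have "direct_pred (containment_order N) V W"
    using assms WN supersets_step[OF assms W]
    unfolding direct_pred_def under_containment_order[OF WN]
    by (auto simp: containment_order_def psubset_eq)
  then show "W \<in> direct_succs N (containment_order N) V"
    using WN unfolding direct_succs_def by blast
qed

text \<open>Every member lies in a set of \<open>A\<close>, so one without a proper superset belongs
  to \<open>A\<close>. Finiteness of the initial nodes thus reduces to that of the first
  partition.\<close>

lemma initial_nodes_N: "initial_nodes N (containment_order N) \<subseteq> A"
proof
  fix V assume V: "V \<in> initial_nodes N (containment_order N)"
  then have VN: "V \<in> N" unfolding initial_nodes_def by blast
  then obtain U where U: "U \<in> A" "(U, V) \<in> desc"
    unfolding N_def by blast
  then have "V \<subseteq> U" "U \<in> N" using descD[of U V] roots(1) A_N by auto
  then have "U = V" using V VN unfolding initial_nodes_def containment_order_def by blast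
  then show "V \<in> A" using U by simp
qed

lemma Union_N: "\<Union> N = \<Union> A"
proof
  show "\<Union> N \<subseteq> \<Union> A"
    unfolding N_def using descD roots(1) by blast
  show "\<Union> A \<subseteq> \<Union> N"
    using A_N by blast
qed

end

section \<open>The tree topology\<close>

locale tree_order =
  fixes T :: "'t set" and r :: "'t rel"
  assumes tree: "tree T r"
begin

abbreviation K :: "'t set set" where "K \<equiv> branches T r"
abbreviation U :: "'t \<Rightarrow> 't set set" where "U \<equiv> branches_through T r"
abbreviation S :: "'t \<Rightarrow> 't set" where "S \<equiv> direct_succs T r"

section \<open>Heights, direct predecessors and direct successors\<close>

lemma r_refl: "t \<in> T \<Longrightarrow> (t, t) \<in> r"
  using tree unfolding tree_def partial_order_on_def preorder_on_def refl_on_def by blast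

lemma r_trans: "(s, t) \<in> r \<Longrightarrow> (t, u) \<in> r \<Longrightarrow> (s, u) \<in> r"
  using tree unfolding tree_def partial_order_on_def preorder_on_def by (meson transD)

lemma r_antisym: "(s, t) \<in> r \<Longrightarrow> (t, s) \<in> r \<Longrightarrow> s = t"
  using tree unfolding tree_def partial_order_on_def by (meson antisymD)

lemma r_carrier: "(s, t) \<in> r \<Longrightarrow> s \<in> T \<and> t \<in> T"
  using tree unfolding tree_def partial_order_on_def preorder_on_def by blast

lemma finite_under: "t \<in> T \<Longrightarrow> finite (under r t)"
  using tree unfolding tree_def by blast

lemma under_comparable: "(s, t) \<in> r \<Longrightarrow> (s', t) \<in> r \<Longrightarrow> (s, s') \<in> r \<or> (s', s) \<in> r"
  using tree r_carrier[of s t] unfolding tree_def Chains_def under_def by blast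

text \<open>\<open>card (under r t)\<close> serves as the height of \<open>t\<close>; extremal
  elements of chains and induction along predecessors come from it.\<close>

lemma card_under_less:
  assumes "(s, t) \<in> r" and "s \<noteq> t"
  shows "card (under r s) < card (under r t)"
proof (rule psubset_card_mono)
  show "finite (under r t)" using finite_under r_carrier[OF assms(1)] by simp
  have "under r s \<subseteq> under r t" using r_trans[OF _ assms(1)] by (auto simp: under_def)
  moreover have "t \<in> under r t" "t \<notin> under r s"
    using r_refl r_carrier[OF assms(1)] r_antisym[OF assms(1)] assms(2) by (auto simp: under_def)
  ultimately show "under r s \<subset> under r t" by blast
qed

lemma chain_min:
  assumes "C \<in> Chains r" and "C \<noteq> {}"
  shows "\<exists>m\<in>C. \<forall>x\<in>C. (m, x) \<in> r"
proof -
  obtain m where m: "m \<in> C" "\<And>x. x \<in> C \<Longrightarrow> card (under r m) \<le> card (under r x)"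
    using ex_has_least_nat[of "\<lambda>x. x \<in> C" _ "\<lambda>x. card (under r x)"] assms(2) by blast
  have "(m, x) \<in> r" if x: "x \<in> C" for x
  proof -
    have "(m, x) \<in> r \<or> (x, m) \<in> r" using assms(1) m(1) x by (auto simp: Chains_def)
    then show ?thesis using card_under_less[of x m] m(2)[OF x] by (cases "x = m") auto
  qed
  then show ?thesis using m(1) by blast
qed

lemma chain_max:
  assumes "C \<in> Chains r" and "C \<noteq> {}" and "finite C"
  shows "\<exists>m\<in>C. \<forall>x\<in>C. (x, m) \<in> r"
proof -
  have fin: "finite ((\<lambda>x. card (under r x)) ` C)" using assms(3) by simp
  have "Max ((\<lambda>x. card (under r x)) ` C) \<in> (\<lambda>x. card (under r x)) ` C"
    using assms(2) by (intro Max_in[OF fin]) simp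
  then obtain m where m: "m \<in> C" "Max ((\<lambda>x. card (under r x)) ` C) = card (under r m)" by blast
  have "(x, m) \<in> r" if x: "x \<in> C" for x
  proof -
    have "card (under r x) \<le> card (under r m)"
      unfolding m(2)[symmetric] using x by (intro Max_ge[OF fin]) simp
    moreover have "(m, x) \<in> r \<or> (x, m) \<in> r" using assms(1) m(1) x by (auto simp: Chains_def)
    ultimately show ?thesis using card_under_less[of m x] by (cases "x = m") auto
  qed
  then show ?thesis using m(1) by blast
qed

lemma ex_direct_pred:
  assumes "(s, t) \<in> r" and "s \<noteq> t"
  obtains u where "direct_pred r u t" "(s, u) \<in> r"
proof -
  have "under r t - {t} \<in> Chains r"
    using under_comparable by (auto simp: Chains_def under_def)
  moreover have "s \<in> under r t - {t}" using assms by (simp add: under_def)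
  moreover have "finite (under r t - {t})" using finite_under r_carrier[OF assms(1)] by simp
  ultimately obtain u where "u \<in> under r t - {t}" "\<forall>x\<in>under r t - {t}. (x, u) \<in> r"
    using chain_max[of "under r t - {t}"] by blast
  then show thesis using that[of u] assms by (auto simp: direct_pred_def under_def)
qed

lemma direct_succsD: "s \<in> S t \<Longrightarrow> (t, s) \<in> r \<and> t \<noteq> s"
  unfolding direct_succs_def direct_pred_def under_def by blast

text \<open>The nodes above \<open>t\<close>, other than \<open>t\<close>, that precede
  \<open>s\<close> form a chain; below its least element there is nothing left but the nodes up to
  \<open>t\<close>.\<close>

lemma ex_direct_succ:
  assumes "(t, s) \<in> r" and "t \<noteq> s"
  obtains u where "u \<in> S t" "(u, s) \<in> r"
proof -
  let ?C = "{u. (u, s) \<in> r \<and> (t, u) \<in> r \<and> u \<noteq> t}"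
  have "s \<in> ?C" using assms r_refl r_carrier by blast
  then have nonempty: "?C \<noteq> {}" by blast
  have "?C \<in> Chains r" using under_comparable by (auto simp: Chains_def)
  then obtain u where u: "u \<in> ?C" "\<forall>x\<in>?C. (u, x) \<in> r"
    using chain_min[OF _ nonempty] by blast
  have "(v, t) \<in> r" if v: "v \<in> under r u - {u}" for v
  proof (rule ccontr)
    assume nv: "(v, t) \<notin> r"
    have vu: "(v, u) \<in> r" "v \<noteq> u" using v by (auto simp: under_def)
    have "(t, v) \<in> r" using nv under_comparable[OF vu(1), of t] u(1) by blast
    moreover have "(v, s) \<in> r" using r_trans[OF vu(1)] u(1) by blast
    moreover have "v \<noteq> t" using nv r_refl r_carrier[OF assms(1)] by blast
    ultimately have "(u, v) \<in> r" using u(2) by blast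
    then show False using r_antisym vu by blast
  qed
  then have "u \<in> S t"
    using u(1) r_carrier unfolding direct_succs_def direct_pred_def under_def by blast
  then show thesis using that u(1) by blast
qed

section \<open>Branches and the sets \<open>U t\<close>\<close>

lemma branch_carrier: "x \<in> K \<Longrightarrow> t \<in> x \<Longrightarrow> t \<in> T"
  unfolding branches_def by blast

lemma branch_chain: "x \<in> K \<Longrightarrow> x \<in> Chains r"
  unfolding branches_def by blast

lemma branch_nonempty: "x \<in> K \<Longrightarrow> x \<noteq> {}"
  unfolding branches_def by blast

lemma branch_comparable: "x \<in> K \<Longrightarrow> s \<in> x \<Longrightarrow> t \<in> x \<Longrightarrow> (s, t) \<in> r \<or> (t, s) \<in> r"
  using branch_chain unfolding Chains_def by blast

text \<open>Closure under direct predecessors extends to all predecessors one level at a time, by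
  induction on the height of \<open>t\<close>.\<close>

lemma branch_downward:
  assumes "x \<in> K"
  shows "t \<in> x \<Longrightarrow> (s, t) \<in> r \<Longrightarrow> s \<in> x"
proof (induction "card (under r t)" arbitrary: t rule: less_induct)
  case less
  show ?case
  proof (cases "s = t")
    case False
    then obtain u where u: "direct_pred r u t" "(s, u) \<in> r"
      using ex_direct_pred less.prems by metis
    then have "u \<in> x" using assms less.prems unfolding branches_def by blast
    moreover have "(u, t) \<in> r" "u \<noteq> t" using u(1) unfolding direct_pred_def under_def by auto
    ultimately show ?thesis using less.hyps card_under_less u(2) by blast
  qed (use less.prems in simp)
qed

lemma under_branch:
  assumes "t \<in> T"
  shows "under r t \<in> K"
proof -
  have "t \<in> under r t" "under r t \<subseteq> T"
    using r_refl[OF assms] r_carrier by (auto simp: under_def)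
  moreover have "under r t \<in> Chains r"
    using under_comparable by (auto simp: Chains_def under_def)
  moreover have "u \<in> under r t" if "s \<in> under r t" "direct_pred r u s" for s u
    using that r_trans[of u s t] by (simp add: direct_pred_def under_def)
  ultimately show ?thesis
    unfolding branches_def by blast
qed

text \<open>The identification of finite branches with nodes: \<open>t\<close> is the maximum of the
  branch.\<close>

lemma finite_branch:
  assumes "x \<in> K" and "finite x"
  obtains t where "t \<in> T" "x = under r t"
proof -
  obtain m where m: "m \<in> x" "\<forall>y\<in>x. (y, m) \<in> r"
    using chain_max[OF branch_chain branch_nonempty] assms by blast
  have "x = under r m" using m branch_downward[OF assms(1) m(1)] by (auto simp: under_def)
  then show thesis using that branch_carrier[OF assms(1) m(1)] by blast
qed

lemma U_iff: "x \<in> U t \<longleftrightarrow> x \<in> K \<and> t \<in> x"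
  unfolding branches_through_def by blast

lemma under_in_U: "t \<in> T \<Longrightarrow> under r t \<in> U t"
  using under_branch r_refl by (simp add: U_iff under_def)

lemma U_mono: "(t, s) \<in> r \<Longrightarrow> U s \<subseteq> U t"
  using branch_downward by (auto simp: U_iff)

lemma U_disjoint: "(s, t) \<notin> r \<Longrightarrow> (t, s) \<notin> r \<Longrightarrow> U s \<inter> U t = {}"
  using branch_comparable[of _ s t] U_iff by blast

lemma U_direct_succs_disjoint:
  assumes "s \<in> S t" and "s' \<in> S t" and "s \<noteq> s'"
  shows "U s \<inter> U s' = {}"
proof -
  \<comment> \<open>A direct successor below another one would be a strict predecessor of it, hence
    would lie below \<open>t\<close>.\<close>
  have "(a, b) \<notin> r" if "a \<in> S t" "b \<in> S t" "a \<noteq> b" for a b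
  proof
    assume "(a, b) \<in> r"
    then have "(a, t) \<in> r" using that unfolding direct_succs_def direct_pred_def under_def by blast
    then show False using direct_succsD[OF that(1)] r_antisym by blast
  qed
  then show ?thesis using assms by (intro U_disjoint) auto
qed

lemma under_notin_U_direct_succ: "s \<in> S t \<Longrightarrow> under r t \<notin> U s"
  using direct_succsD r_antisym by (auto simp: U_iff under_def)

section \<open>Laminar families of basic clopen sets\<close>

text \<open>For finite \<open>F \<subseteq> S t\<close> these are the members of
  \<open>basic_clopens\<close>. Naming the node \<open>t\<close> allows families with one set per
  node; the set contains the branch \<open>under r t\<close> that stands for
  \<open>t\<close>.\<close>

definition punctured :: "'t \<Rightarrow> 't set \<Rightarrow> 't set set" where
  "punctured t F = U t - (\<Union>s\<in>F. U s)"

lemma punctured_basic: "t \<in> T \<Longrightarrow> F \<subseteq> S t \<Longrightarrow> finite F \<Longrightarrow> punctured t F \<in> basic_clopens T r"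
  unfolding punctured_def basic_clopens_def by blast

lemma under_in_punctured: "t \<in> T \<Longrightarrow> F \<subseteq> S t \<Longrightarrow> under r t \<in> punctured t F"
  unfolding punctured_def using under_in_U under_notin_U_direct_succ by blast

text \<open>All branches through \<open>t'\<close> pass through a single direct successor
  \<open>s\<close> of \<open>t\<close>. Either \<open>U s\<close> has been removed at
  \<open>t\<close>, or it is contained in \<open>punctured t F\<close> as a whole.\<close>

lemma punctured_laminar:
  assumes "(t, t') \<in> r" "t \<noteq> t'" "F \<subseteq> S t"
  shows "disjnt (punctured t F) (punctured t' F') \<or> punctured t' F' \<subseteq> punctured t F"
proof -
  obtain s where s: "s \<in> S t" "(s, t') \<in> r" using ex_direct_succ assms by metis
  have sub: "punctured t' F' \<subseteq> U s" using U_mono[OF s(2)] unfolding punctured_def by blast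
  show ?thesis
  proof (cases "s \<in> F")
    case True
    then show ?thesis using sub unfolding disjnt_def punctured_def by blast
  next
    case False
    have "U s \<subseteq> U t" using U_mono direct_succsD[OF s(1)] by blast
    moreover have "U s \<inter> U s' = {}" if "s' \<in> F" for s'
      using U_direct_succs_disjoint[OF s(1), of s'] that assms(3) False by blast
    ultimately have "U s \<subseteq> punctured t F" unfolding punctured_def by blast
    then show ?thesis using sub by blast
  qed
qed

text \<open>No covered point is lost: among the nodes whose set contains \<open>x\<close>, one of
  least height survives, since by laminarity a lower node whose set meets its set would have a set
  containing \<open>x\<close> too.\<close>

lemma disjoint_subfamily:
  assumes "D \<subseteq> T" and "\<And>t. t \<in> D \<Longrightarrow> F t \<subseteq> S t"
  obtains I where "I \<subseteq> D" "pairwise disjnt ((\<lambda>t. punctured t (F t)) ` I)"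
    "(\<Union>t\<in>I. punctured t (F t)) = (\<Union>t\<in>D. punctured t (F t))"
proof -
  let ?V = "\<lambda>t. punctured t (F t)"
  define I where "I = {t \<in> D. \<forall>u\<in>D. (u, t) \<in> r \<longrightarrow> u \<noteq> t \<longrightarrow> disjnt (?V u) (?V t)}"
  have "disjnt (?V t) (?V u)" if tu: "t \<in> I" "u \<in> I" "t \<noteq> u" for t u
  proof -
    consider "(t, u) \<in> r" | "(u, t) \<in> r" | "(t, u) \<notin> r" "(u, t) \<notin> r" by blast
    then show ?thesis
    proof cases
      case 3
      then show ?thesis using U_disjoint[of t u] unfolding disjnt_def punctured_def by blast
    qed (use tu in \<open>auto simp: I_def disjnt_sym\<close>)
  qed
  then have disj: "pairwise disjnt (?V ` I)"
    by (auto simp: pairwise_def)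
  have "x \<in> (\<Union>t\<in>I. ?V t)" if t: "t \<in> D" "x \<in> ?V t" for x t
  proof -
    obtain m where m: "m \<in> D \<and> x \<in> ?V m"
        "\<And>u. u \<in> D \<and> x \<in> ?V u \<Longrightarrow> card (under r m) \<le> card (under r u)"
      using ex_has_least_nat[of "\<lambda>u. u \<in> D \<and> x \<in> ?V u" t "\<lambda>u. card (under r u)"] t by blast
    have "disjnt (?V u) (?V m)" if u: "u \<in> D" "(u, m) \<in> r" "u \<noteq> m" for u
    proof (rule ccontr)
      assume "\<not> disjnt (?V u) (?V m)"
      then have "?V m \<subseteq> ?V u" using punctured_laminar u assms(2) by blast
      then have "card (under r m) \<le> card (under r u)" using m u(1) by blast
      then show False using card_under_less u by fastforce
    qed
    then have "m \<in> I" using m unfolding I_def by blast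
    then show ?thesis using m by blast
  qed
  moreover have "I \<subseteq> D" unfolding I_def by blast
  ultimately show thesis using that[of I] disj by blast
qed

section \<open>Neighbourhood bases of the tree topology\<close>

text \<open>Openness in terms of neighbourhood bases: the sets \<open>U t\<close> with
  \<open>t \<in> x\<close> at an infinite branch \<open>x\<close>, and the sets
  \<open>punctured t F\<close> at a node \<open>t\<close>.\<close>

definition nhd_open :: "'t set set \<Rightarrow> bool" where
  "nhd_open Q \<longleftrightarrow> Q \<subseteq> K \<and> (\<forall>x\<in>Q. infinite x \<longrightarrow> (\<exists>t\<in>x. U t \<subseteq> Q)) \<and>
    (\<forall>t\<in>T. under r t \<in> Q \<longrightarrow> (\<exists>F\<subseteq>S t. finite F \<and> punctured t F \<subseteq> Q))"

lemma nhd_openI: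
  assumes "Q \<subseteq> K" and "\<And>x. x \<in> Q \<Longrightarrow> infinite x \<Longrightarrow> \<exists>t\<in>x. U t \<subseteq> Q"
    and "\<And>t. t \<in> T \<Longrightarrow> under r t \<in> Q \<Longrightarrow> \<exists>F\<subseteq>S t. finite F \<and> punctured t F \<subseteq> Q"
  shows "nhd_open Q"
  unfolding nhd_open_def using assms by simp

lemma nhd_openD:
  assumes "nhd_open Q"
  shows "Q \<subseteq> K" and "x \<in> Q \<Longrightarrow> infinite x \<Longrightarrow> \<exists>t\<in>x. U t \<subseteq> Q"
    and "t \<in> T \<Longrightarrow> under r t \<in> Q \<Longrightarrow> \<exists>F\<subseteq>S t. finite F \<and> punctured t F \<subseteq> Q"
  using assms unfolding nhd_open_def by simp_all

lemma nhd_open_Int: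
  assumes a: "nhd_open a" and b: "nhd_open b"
  shows "nhd_open (a \<inter> b)"
proof (rule nhd_openI)
  show "a \<inter> b \<subseteq> K" using nhd_openD(1)[OF a] by blast
  show "\<exists>t\<in>x. U t \<subseteq> a \<inter> b" if x: "x \<in> a \<inter> b" "infinite x" for x
  proof -
    obtain s where s: "s \<in> x" "U s \<subseteq> a" using nhd_openD(2)[OF a] x by blast
    obtain t where t: "t \<in> x" "U t \<subseteq> b" using nhd_openD(2)[OF b] x by blast
    have "x \<in> K" using x nhd_openD(1)[OF a] by blast
    then have "(s, t) \<in> r \<or> (t, s) \<in> r" using s(1) t(1) by (rule branch_comparable)
    then show ?thesis using U_mono[of s t] U_mono[of t s] s t by blast
  qed
  show "\<exists>F\<subseteq>S t. finite F \<and> punctured t F \<subseteq> a \<inter> b" if t: "t \<in> T" "under r t \<in> a \<inter> b" for t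
  proof -
    obtain F where F: "F \<subseteq> S t" "finite F" "punctured t F \<subseteq> a"
      using nhd_openD(3)[OF a t(1)] t(2) by blast
    obtain F' where F': "F' \<subseteq> S t" "finite F'" "punctured t F' \<subseteq> b"
      using nhd_openD(3)[OF b t(1)] t(2) by blast
    have "punctured t (F \<union> F') \<subseteq> a \<inter> b"
      using F(3) F'(3) unfolding punctured_def by blast
    then show ?thesis using F(1,2) F'(1,2) by (intro exI[of _ "F \<union> F'"]) simp
  qed
qed

lemma nhd_open_Union:
  assumes "\<And>a. a \<in> A \<Longrightarrow> nhd_open a"
  shows "nhd_open (\<Union>A)"
proof (rule nhd_openI)
  show "\<Union>A \<subseteq> K" using nhd_openD(1)[OF assms] by blast
  show "\<exists>t\<in>x. U t \<subseteq> \<Union>A" if x: "x \<in> \<Union>A" "infinite x" for x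
  proof -
    obtain a where a: "a \<in> A" "x \<in> a" using x(1) by blast
    then show ?thesis using nhd_openD(2)[OF assms[OF a(1)] a(2) x(2)] by blast
  qed
  show "\<exists>F\<subseteq>S t. finite F \<and> punctured t F \<subseteq> \<Union>A" if t: "t \<in> T" "under r t \<in> \<Union>A" for t
  proof -
    obtain a where a: "a \<in> A" "under r t \<in> a" using t(2) by blast
    then obtain F where "F \<subseteq> S t" "finite F" "punctured t F \<subseteq> a"
      using nhd_openD(3)[OF assms[OF a(1)] t(1)] by blast
    then show ?thesis using a(1) by blast
  qed
qed

lemma nhd_open_U:
  assumes "s \<in> T"
  shows "nhd_open (U s)"
proof (rule nhd_openI)
  show "\<exists>F\<subseteq>S t. finite F \<and> punctured t F \<subseteq> U s" if t: "t \<in> T" "under r t \<in> U s" for t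
  proof -
    have "(s, t) \<in> r" using t(2) by (simp add: U_iff under_def)
    then have "punctured t {} \<subseteq> U s" using U_mono[of s t] by (simp add: punctured_def)
    then show ?thesis by blast
  qed
qed (use U_iff in blast)+

lemma nhd_open_Compl_U:
  assumes s: "s \<in> T"
  shows "nhd_open (K - U s)"
proof (rule nhd_openI)
  show "\<exists>t\<in>x. U t \<subseteq> K - U s" if x: "x \<in> K - U s" "infinite x" for x
  proof -
    have xs: "x \<in> K" "s \<notin> x" using x(1) by (auto simp: U_iff)
    \<comment> \<open>An infinite branch does not fit into the finite set \<open>under r s\<close>;
      a node of it outside that set is incomparable to \<open>s\<close>.\<close>
    have "\<not> x \<subseteq> under r s" using finite_under[OF s] x(2) finite_subset by blast
    then obtain t where t: "t \<in> x" "t \<notin> under r s" by blast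
    have "(t, s) \<notin> r" using t(2) by (simp add: under_def)
    moreover have "(s, t) \<notin> r" using branch_downward[OF xs(1) t(1)] xs(2) by blast
    ultimately have "U t \<inter> U s = {}" by (rule U_disjoint)
    then have "U t \<subseteq> K - U s" using U_iff by blast
    then show ?thesis using t(1) by blast
  qed
  show "\<exists>F\<subseteq>S t. finite F \<and> punctured t F \<subseteq> K - U s" if t: "t \<in> T" "under r t \<in> K - U s" for t
  proof -
    have st: "(s, t) \<notin> r" using t(2) by (simp add: U_iff under_def)
    have pK: "punctured t F \<subseteq> K" for F unfolding punctured_def using U_iff by blast
    show ?thesis
    proof (cases "(t, s) \<in> r")
      case True
      moreover have "t \<noteq> s" using st r_refl[OF s] by blast
      ultimately obtain u where u: "u \<in> S t" "(u, s) \<in> r" by (rule ex_direct_succ)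
      \<comment> \<open>It is enough to remove the one direct successor that leads towards
        \<open>s\<close>.\<close>
      have "punctured t {u} \<subseteq> K - U s"
        using U_mono[OF u(2)] pK[of "{u}"] unfolding punctured_def by blast
      then show ?thesis using u(1) by (intro exI[of _ "{u}"]) simp
    next
      case False
      then have "punctured t {} \<subseteq> K - U s"
        using U_disjoint[OF st] pK[of "{}"] unfolding punctured_def by blast
      then show ?thesis by blast
    qed
  qed
qed blast

text \<open>Turns openness in the generated topology into the existence of basic neighbourhoods, the
  form in which the covering arguments use it.\<close>

lemma openin_tree_topology_nhd_open:
  assumes "openin (tree_topology T r) Q"
  shows "nhd_open Q"
proof -
  have "generate_topology_on (\<Union>t\<in>T. {U t, K - U t}) Q"
    using assms unfolding tree_topology_def openin_topology_generated_by_iff .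
  then show ?thesis
  proof (induction rule: generate_topology_on.induct)
    case Empty
    show ?case by (rule nhd_openI) auto
  next
    case (Int a b)
    show ?case by (rule nhd_open_Int[OF Int.IH])
  next
    case (UN A)
    show ?case by (rule nhd_open_Union[OF UN.IH])
  next
    case (Basis Q)
    then show ?case using nhd_open_U nhd_open_Compl_U by auto
  qed
qed

lemmas openin_tree_topology_nhd = nhd_openD[OF openin_tree_topology_nhd_open]

lemma openin_tree_topology_U:
  assumes "t \<in> T"
  shows "openin (tree_topology T r) (U t)" "openin (tree_topology T r) (K - U t)"
  unfolding tree_topology_def using assms by (auto intro!: topology_generated_by_Basis)

lemma topspace_tree_topology: "topspace (tree_topology T r) = K"
proof
  show "topspace (tree_topology T r) \<subseteq> K"
    using openin_tree_topology_nhd(1) openin_topspace by blast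
  show "K \<subseteq> topspace (tree_topology T r)"
  proof
    fix x assume x: "x \<in> K"
    then obtain t where "t \<in> x" using branch_nonempty by blast
    then have "x \<in> U t" "t \<in> T" using x branch_carrier by (auto simp: U_iff)
    then show "x \<in> topspace (tree_topology T r)"
      using openin_subset openin_tree_topology_U(1) by blast
  qed
qed

lemma openin_basic_clopens:
  assumes "V \<in> basic_clopens T r"
  shows "openin (tree_topology T r) V"
proof -
  obtain t F where V: "V = U t - (\<Union>s\<in>F. U s)" "t \<in> T" "F \<subseteq> S t" "finite F"
    using assms unfolding basic_clopens_def by blast
  have FT: "F \<subseteq> T" using V(3) unfolding direct_succs_def by blast
  have "closedin (tree_topology T r) (\<Union>s\<in>F. U s)"
  proof (intro closedin_Union)
    show "closedin (tree_topology T r) A" if "A \<in> U ` F" for A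
      using that FT openin_tree_topology_U(2)
      by (auto simp: closedin_def topspace_tree_topology U_iff)
  qed (use V(4) in simp)
  then show ?thesis
    unfolding V(1) using openin_tree_topology_U(1)[OF V(2)] by (rule openin_diff[rotated])
qed

lemma basic_clopens_nonempty: "V \<in> basic_clopens T r \<Longrightarrow> V \<noteq> {}"
  using under_in_punctured unfolding basic_clopens_def punctured_def by blast

section \<open>Bar induction, compactness and partitions\<close>

text \<open>If \<open>\<phi>\<close> fails at \<open>t\<close>, then \<open>step\<close> keeps
  producing direct successors where it fails; they run along an infinite branch and contradict
  \<open>bar\<close>.\<close>

lemma tree_bar_induct:
  assumes "t \<in> T"
    and bar: "\<And>x. x \<in> K \<Longrightarrow> infinite x \<Longrightarrow> \<exists>u\<in>x. \<forall>v\<in>x. (u, v) \<in> r \<longrightarrow> \<phi> v"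
    and step: "\<And>t. t \<in> T \<Longrightarrow> \<exists>F\<subseteq>S t. (\<forall>s\<in>F. \<phi> s) \<longrightarrow> \<phi> t"
  shows "\<phi> t"
proof (rule ccontr)
  assume "\<not> \<phi> t"
  then have start: "t \<in> T \<and> \<not> \<phi> t" using assms(1) by blast
  have succ: "\<exists>s. (s \<in> T \<and> \<not> \<phi> s) \<and> s \<in> S t" if "t \<in> T \<and> \<not> \<phi> t" for t
    using step[of t] that unfolding direct_succs_def by blast
  obtain g where g: "\<And>n::nat. g n \<in> T \<and> \<not> \<phi> (g n)" "\<And>n. g (Suc n) \<in> S (g n)"
    using dependent_nat_choice[of "\<lambda>_ t. t \<in> T \<and> \<not> \<phi> t" "\<lambda>_ t s. s \<in> S t"] start succ by metis
  have mono: "(g m, g n) \<in> r" if "m \<le> n" for m n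
    using that
  proof (induction rule: dec_induct)
    case base
    then show ?case using g(1) r_refl by blast
  next
    case (step n)
    then show ?case using direct_succsD[OF g(2)] r_trans by blast
  qed
  \<comment> \<open>The downward closure of the sequence is the infinite branch that it
    determines.\<close>
  define x where "x = (\<Union>n. under r (g n))"
  have x_iff: "s \<in> x \<longleftrightarrow> (\<exists>n. (s, g n) \<in> r)" for s
    unfolding x_def under_def by blast
  have "x \<in> Chains r"
    unfolding Chains_def
  proof (intro CollectI ballI)
    fix a b assume "a \<in> x" "b \<in> x"
    then obtain m n where mn: "(a, g m) \<in> r" "(b, g n) \<in> r" unfolding x_iff by blast
    have "(a, g (max m n)) \<in> r" using r_trans[OF mn(1) mono] by simp
    moreover have "(b, g (max m n)) \<in> r" using r_trans[OF mn(2) mono] by simp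
    ultimately show "(a, b) \<in> r \<or> (b, a) \<in> r" by (rule under_comparable)
  qed
  moreover have gx: "g n \<in> x" for n unfolding x_iff using mono by blast
  moreover have "u \<in> x" if "s \<in> x" "direct_pred r u s" for s u
    using that r_trans unfolding x_iff direct_pred_def under_def by blast
  ultimately have xK: "x \<in> K"
    unfolding branches_def using r_carrier x_iff by blast
  \<comment> \<open>A finite \<open>x\<close> would have a top node \<open>m\<close> below some
    \<open>g n\<close>, while \<open>g (Suc n)\<close> also lies in \<open>x\<close>, hence below
    \<open>m\<close>.\<close>
  have "infinite x"
  proof
    assume "finite x"
    then obtain m where m: "m \<in> T" "x = under r m" using finite_branch xK by blast
    then have "m \<in> x" using r_refl by (simp add: under_def)
    then obtain n where "(m, g n) \<in> r" using x_iff by blast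
    moreover have "(g (Suc n), m) \<in> r" using gx m by (auto simp: under_def)
    ultimately have "(g (Suc n), g n) \<in> r" by (meson r_trans)
    then show False using direct_succsD[OF g(2)] r_antisym by blast
  qed
  then obtain u where u: "u \<in> x" "\<forall>v\<in>x. (u, v) \<in> r \<longrightarrow> \<phi> v" using bar xK by blast
  then obtain n where "(u, g n) \<in> r" using x_iff by blast
  then show False using u gx g(1) by blast
qed

text \<open>Compactness by bar induction on the property that \<open>U t\<close> meets only finitely
  many members of \<open>P\<close>. Along an infinite branch \<open>U u\<close> eventually lies in
  one member; at a node, the member containing it covers all of \<open>U t\<close> except finitely
  many \<open>U s\<close>.\<close>

lemma finite_disjoint_open_cover:
  assumes fin: "finite (initial_nodes T r)"
    and P: "\<And>V. V \<in> P \<Longrightarrow> openin (tree_topology T r) V" "pairwise disjnt P" "\<Union>P = K" "{} \<notin> P"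
  shows "finite P"
proof -
  have "finite {V \<in> P. V \<inter> U t \<noteq> {}}" if "t \<in> T" for t
    using that
  proof (rule tree_bar_induct)
    fix x assume x: "x \<in> K" "infinite x"
    then obtain V where V: "V \<in> P" "x \<in> V" using P(3) by blast
    obtain u where u: "u \<in> x" "U u \<subseteq> V" using openin_tree_topology_nhd(2)[OF P(1)[OF V(1)] V(2) x(2)] by blast
    have "finite {W \<in> P. W \<inter> U v \<noteq> {}}" if "(u, v) \<in> r" for v
    proof -
      have "W = V" if "W \<in> P" "W \<inter> U v \<noteq> {}" for W
      proof (rule ccontr)
        assume "W \<noteq> V"
        then have "W \<inter> V = {}" using P(2) V(1) that(1) by (auto simp: pairwise_def disjnt_def)
        then show False using U_mono[OF \<open>(u, v) \<in> r\<close>] u(2) that(2) by blast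
      qed
      then have "{W \<in> P. W \<inter> U v \<noteq> {}} \<subseteq> {V}" by blast
      then show ?thesis by (rule finite_subset) simp
    qed
    then show "\<exists>u\<in>x. \<forall>v\<in>x. (u, v) \<in> r \<longrightarrow> finite {W \<in> P. W \<inter> U v \<noteq> {}}" using u(1) by blast
  next
    fix t assume t: "t \<in> T"
    obtain V where V: "V \<in> P" "under r t \<in> V" using P(3) under_branch[OF t] by blast
    obtain F where F: "F \<subseteq> S t" "finite F" "punctured t F \<subseteq> V"
      using openin_tree_topology_nhd(3)[OF P(1)[OF V(1)] t V(2)] by blast
    have "finite {W \<in> P. W \<inter> U t \<noteq> {}}" if "\<forall>s\<in>F. finite {W \<in> P. W \<inter> U s \<noteq> {}}"
    proof -
      have "W = V \<or> (\<exists>s\<in>F. W \<inter> U s \<noteq> {})" if "W \<in> P" "W \<inter> U t \<noteq> {}" for W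
      proof (cases "W = V")
        case False
        then have "W \<inter> V = {}" using P(2) V(1) that(1) by (auto simp: pairwise_def disjnt_def)
        then show ?thesis using F(3) that(2) unfolding punctured_def by blast
      qed simp
      then have "{W \<in> P. W \<inter> U t \<noteq> {}} \<subseteq> insert V (\<Union>s\<in>F. {W \<in> P. W \<inter> U s \<noteq> {}})" by blast
      moreover have "finite (insert V (\<Union>s\<in>F. {W \<in> P. W \<inter> U s \<noteq> {}}))" using F(2) that by simp
      ultimately show ?thesis by (rule finite_subset)
    qed
    then show "\<exists>F\<subseteq>S t. (\<forall>s\<in>F. finite {W \<in> P. W \<inter> U s \<noteq> {}}) \<longrightarrow> finite {W \<in> P. W \<inter> U t \<noteq> {}}"
      using F(1) by blast
  qed
  then have "finite (\<Union>t\<in>initial_nodes T r. {V \<in> P. V \<inter> U t \<noteq> {}})"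
    using fin by (simp add: initial_nodes_def)
  moreover have "P \<subseteq> (\<Union>t\<in>initial_nodes T r. {V \<in> P. V \<inter> U t \<noteq> {}})"
  proof
    fix V assume V: "V \<in> P"
    then have "V \<noteq> {}" using P(4) by blast
    then obtain x where x: "x \<in> V" by blast
    then have xK: "x \<in> K" using V P(3) by blast
    \<comment> \<open>The minimum of a branch is an initial node, so the sets \<open>U t\<close> of
      the finitely many initial nodes cover \<open>K\<close>.\<close>
    obtain m where m: "m \<in> x" "\<forall>y\<in>x. (m, y) \<in> r"
      using chain_min[OF branch_chain[OF xK] branch_nonempty[OF xK]] by blast
    have "m \<in> initial_nodes T r"
      unfolding initial_nodes_def
      using m branch_carrier[OF xK] branch_downward[OF xK m(1)] r_antisym by blast
    moreover have "x \<in> V \<inter> U m" using x xK m(1) by (simp add: U_iff)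
    ultimately show "V \<in> (\<Union>t\<in>initial_nodes T r. {V \<in> P. V \<inter> U t \<noteq> {}})" using V by blast
  qed
  ultimately show ?thesis by (rule finite_subset[rotated])
qed

text \<open>Choose one set from \<open>G\<close> inside \<open>Q\<close> for every node in
  \<open>Q\<close>, make sure that infinite branches are covered as well, and thin out with
  \<open>disjoint_subfamily\<close>.\<close>

lemma open_partition:
  assumes "openin (tree_topology T r) Q"
    and local: "\<And>x. x \<in> K \<Longrightarrow> \<exists>Q'. openin (tree_topology T r) Q' \<and> x \<in> Q' \<and>
      (\<forall>V\<in>basic_clopens T r. x \<in> V \<longrightarrow> V \<subseteq> Q' \<longrightarrow> V \<in> G)"
  shows "\<exists>P\<subseteq>G. pairwise disjnt P \<and> \<Union>P = Q"
proof -
  define D where "D = {t \<in> T. under r t \<in> Q}"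
  have small: "\<exists>F\<subseteq>S t. finite F \<and> punctured t F \<in> G \<and> punctured t F \<subseteq> Q" if t: "t \<in> D" for t
  proof -
    have tT: "t \<in> T" using t D_def by blast
    obtain Q' where Q': "openin (tree_topology T r) Q'" "under r t \<in> Q'"
        "\<forall>V\<in>basic_clopens T r. under r t \<in> V \<longrightarrow> V \<subseteq> Q' \<longrightarrow> V \<in> G"
      using local[OF under_branch[OF tT]] by blast
    have "openin (tree_topology T r) (Q \<inter> Q')"
      using assms(1) Q'(1) by (rule openin_Int)
    moreover have "under r t \<in> Q \<inter> Q'"
      using t Q'(2) unfolding D_def by blast
    ultimately obtain F where F: "F \<subseteq> S t" "finite F" "punctured t F \<subseteq> Q \<inter> Q'"
      using openin_tree_topology_nhd(3)[OF _ tT] by blast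
    then have "punctured t F \<in> G"
      using Q'(3) punctured_basic[OF tT F(1,2)] under_in_punctured[OF tT F(1)] by blast
    then show ?thesis using F by blast
  qed
  \<comment> \<open>The last clause, to take all of \<open>U t\<close> whenever possible, is for the
    infinite branches: such a branch might pass through a removed \<open>U s\<close> at each of its
    nodes, but near its end the full \<open>U t\<close> is admissible.\<close>
  have "\<exists>F\<subseteq>S t. finite F \<and> punctured t F \<in> G \<and> punctured t F \<subseteq> Q \<and> (U t \<in> G \<longrightarrow> U t \<subseteq> Q \<longrightarrow> F = {})"
    if t: "t \<in> D" for t
  proof (cases "U t \<in> G \<and> U t \<subseteq> Q")
    case True
    then show ?thesis by (intro exI[of _ "{}"]) (simp add: punctured_def)
  qed (use small[OF t] in blast)
  then obtain F where F: "\<And>t. t \<in> D \<Longrightarrow> F t \<subseteq> S t" "\<And>t. t \<in> D \<Longrightarrow> punctured t (F t) \<in> G"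
      "\<And>t. t \<in> D \<Longrightarrow> punctured t (F t) \<subseteq> Q"
      "\<And>t. t \<in> D \<Longrightarrow> U t \<in> G \<Longrightarrow> U t \<subseteq> Q \<Longrightarrow> F t = {}"
    by metis
  obtain I where I: "I \<subseteq> D" "pairwise disjnt ((\<lambda>t. punctured t (F t)) ` I)"
      "(\<Union>t\<in>I. punctured t (F t)) = (\<Union>t\<in>D. punctured t (F t))"
    using disjoint_subfamily[of D F] F(1) unfolding D_def by blast
  have "x \<in> (\<Union>t\<in>D. punctured t (F t))" if x: "x \<in> Q" for x
  proof -
    have xK: "x \<in> K" using x openin_tree_topology_nhd(1)[OF assms(1)] by blast
    show ?thesis
    proof (cases "finite x")
      case True
      then obtain t where t: "t \<in> T" "x = under r t" using finite_branch xK by blast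
      then have "t \<in> D" using x D_def by blast
      then show ?thesis using under_in_punctured[OF t(1) F(1)] t(2) by blast
    next
      case False
      obtain Q' where Q': "openin (tree_topology T r) Q'" "x \<in> Q'"
          "\<forall>V\<in>basic_clopens T r. x \<in> V \<longrightarrow> V \<subseteq> Q' \<longrightarrow> V \<in> G"
        using local[OF xK] by blast
      have "openin (tree_topology T r) (Q \<inter> Q')"
        using assms(1) Q'(1) by (rule openin_Int)
      moreover have "x \<in> Q \<inter> Q'" using x Q'(2) by blast
      ultimately obtain t where t: "t \<in> x" "U t \<subseteq> Q \<inter> Q'"
        using openin_tree_topology_nhd(2) False by blast
      have tT: "t \<in> T" using branch_carrier[OF xK t(1)] .
      have "t \<in> D" using under_in_U[OF tT] t(2) tT D_def by blast
      have "U t \<in> basic_clopens T r"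
        using punctured_basic[OF tT, of "{}"] by (simp add: punctured_def)
      moreover have "x \<in> U t" using xK t(1) by (simp add: U_iff)
      ultimately have "U t \<in> G" using Q'(3) t(2) by blast
      then have "F t = {}" using F(4)[OF \<open>t \<in> D\<close>] t(2) by blast
      then have "x \<in> punctured t (F t)" using xK t(1) by (simp add: punctured_def U_iff)
      then show ?thesis using \<open>t \<in> D\<close> by blast
    qed
  qed
  then have "(\<Union>t\<in>D. punctured t (F t)) = Q" using F(3) by blast
  then show ?thesis
    using I F(2) by (intro exI[of _ "(\<lambda>t. punctured t (F t)) ` I"]) auto
qed

end

section \<open>The refining family\<close>

theorem theorem4p2:
  fixes T :: "'a set" and r :: "'a rel"
    and d :: "'a set \<Rightarrow> 'a set \<Rightarrow> real" and \<epsilon> :: real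
    and \<eta> lam :: "'a set set ordinal" and n :: nat
  assumes "tree T r" and "T \<noteq> {}" and "finite (initial_nodes T r)"
    and "pseudo_metric_on (branches T r) d"
    and "fragmentable (tree_topology T r) d"
    and "0 < \<epsilon>"
    and "Frag (tree_topology T r) d (branches T r) \<epsilon> = osucc \<eta>"
    and "limit_ordinal lam" and "\<eta> = (osucc ^^ n) lam"
  shows "\<exists>\<N>. \<N> \<subseteq> basic_clopens T r \<and>
    well_founded_tree \<N> (containment_order \<N>) \<and>
    (\<forall>M\<in>\<N>. d_diam d (M - \<Union> (direct_succs \<N> (containment_order \<N>) M)) < ennreal \<epsilon>) \<and>
    ordinal_index \<N> (containment_order \<N>) \<le> (osucc ^^ (2 * n + 2)) lam \<and>
    \<Union> \<N> = branches T r \<and>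
    finite (initial_nodes \<N> (containment_order \<N>))"
proof -
  interpret tree_order T r
    by unfold_locales (rule assms(1))
  let ?X = "tree_topology T r"
  define Q :: "'a set set ordinal \<Rightarrow> 'a set set"
    where "Q = iter_deriv (frag_deriv ?X d \<epsilon>) K"
  have closed_K: "closedin ?X K"
    using closedin_topspace[of ?X] unfolding topspace_tree_topology .
  have closed_Q: "closedin ?X (Q \<gamma>)" for \<gamma>
    unfolding Q_def using closed_K by (intro closedin_iter_deriv closedin_frag_deriv)
  have Q_mono: "\<alpha> \<le> \<beta> \<Longrightarrow> Q \<beta> \<subseteq> Q \<alpha>" for \<alpha> \<beta>
    unfolding Q_def by (rule iter_deriv_antimono[OF frag_deriv_subset])
  \<comment> \<open>Points have type \<open>'a set\<close> and the ordinals are built over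
    \<open>'a set set\<close>, so singletons provide the injection.\<close>
  have "\<exists>\<beta> :: 'a set set ordinal. iter_deriv (frag_deriv ?X d \<epsilon>) K \<beta> = {}"
    using assms(5,6) closed_K by (intro iter_frag_deriv_empty[where h = "\<lambda>x. {x}"]) simp_all
  then have "iter_deriv (frag_deriv ?X d \<epsilon>) K (LEAST \<beta> :: 'a set set ordinal. iter_deriv (frag_deriv ?X d \<epsilon>) K \<beta> = {}) = {}"
    by (rule LeastI_ex)
  then have Q_end: "Q (osucc \<eta>) = {}"
    using assms(7) unfolding Frag_def Q_def by simp

  \<comment> \<open>As \<open>Q\<close> decreases, meeting \<open>Q \<gamma>\<close> and missing
    \<open>Q (osucc \<gamma>)\<close> determines \<open>\<gamma>\<close>; the choice in
    \<open>f\<close> below is therefore forced.\<close>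
  define good where "good V \<gamma> \<longleftrightarrow>
    V \<inter> Q \<gamma> \<noteq> {} \<and> V \<inter> Q (osucc \<gamma>) = {} \<and> d_diam d (V \<inter> Q \<gamma>) < ennreal \<epsilon>" for V \<gamma>
  define G where "G = {V \<in> basic_clopens T r. \<exists>\<gamma>. good V \<gamma>}"
  define f where "f V = (SOME \<gamma>. good V \<gamma>)" for V
  have f: "good V (f V)" if "V \<in> G" for V
    using that unfolding f_def G_def by (auto intro: someI_ex)

  have local: "\<exists>Q'. openin ?X Q' \<and> x \<in> Q' \<and> (\<forall>V\<in>basic_clopens T r. x \<in> V \<longrightarrow> V \<subseteq> Q' \<longrightarrow> V \<in> G)"
    if x: "x \<in> K" for x
  proof -
    have "x \<notin> iter_deriv (frag_deriv ?X d \<epsilon>) K (osucc \<eta>)"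
      using Q_end unfolding Q_def by simp
    then obtain \<gamma> where \<gamma>: "x \<in> Q \<gamma>" "x \<notin> Q (osucc \<gamma>)"
      unfolding Q_def by (rule iter_deriv_last_stage[OF x])
    have succ: "Q (osucc \<gamma>) = frag_deriv ?X d \<epsilon> (Q \<gamma>)"
      unfolding Q_def by (rule iter_deriv_osucc)
    obtain Q' where Q': "openin ?X Q'" "x \<in> Q'" "\<not> ennreal \<epsilon> \<le> d_diam d (Q' \<inter> Q \<gamma>)"
      using \<gamma> unfolding succ frag_deriv_def by blast
    have "good V \<gamma>" if V: "x \<in> V" "V \<subseteq> Q'" for V
    proof -
      have "d_diam d (V \<inter> Q \<gamma>) \<le> d_diam d (Q' \<inter> Q \<gamma>)"
        using V by (intro d_diam_mono) blast
      then have "d_diam d (V \<inter> Q \<gamma>) < ennreal \<epsilon>"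
        using Q'(3) by (meson le_less_trans not_le)
      \<comment> \<open>A point of \<open>V\<close> in the next derivative would have
        \<open>Q'\<close> as a neighbourhood with small trace.\<close>
      moreover have "V \<inter> Q (osucc \<gamma>) = {}"
        using V(2) Q'(3) frag_derivD[OF _ Q'(1), of _ d \<epsilon> "Q \<gamma>"] unfolding succ by blast
      moreover have "V \<inter> Q \<gamma> \<noteq> {}"
        using V(1) \<gamma>(1) by blast
      ultimately show ?thesis unfolding good_def by simp
    qed
    then show ?thesis
      using Q'(1,2) unfolding G_def by blast
  qed

  define P where "P W = (SOME P. P \<subseteq> G \<and> pairwise disjnt P \<and> \<Union>P = W)" for W
  have P: "P W \<subseteq> G \<and> pairwise disjnt (P W) \<and> \<Union>(P W) = W" if "openin ?X W" for W
    unfolding P_def by (rule someI_ex) (rule open_partition[OF that local])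
  define c where "c V = P (V - Q (f V))" for V
  have G_open: "openin ?X V" if "V \<in> G" for V
    using that openin_basic_clopens unfolding G_def by simp
  have open_c: "openin ?X (V - Q (f V))" if "V \<in> G" for V
    using G_open[OF that] closed_Q by (rule openin_diff)
  have open_K: "openin ?X K"
    using openin_topspace[of ?X] unfolding topspace_tree_topology .

  interpret refinement G "P K" c f
  proof
    show "V \<noteq> {}" if "V \<in> G" for V
      using that basic_clopens_nonempty unfolding G_def by simp
    show "P K \<subseteq> G" "pairwise disjnt (P K)"
      using P[OF open_K] by simp_all
    show "c V \<subseteq> G" "pairwise disjnt (c V)" if "V \<in> G" for V
      using P[OF open_c[OF that]] unfolding c_def by simp_all
    fix V W assume VW: "V \<in> G" "W \<in> c V"
    have W: "W \<in> G" "W \<subseteq> V - Q (f V)"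
      using P[OF open_c[OF VW(1)]] VW(2) unfolding c_def by auto
    then show "W \<subseteq> V" by blast
    \<comment> \<open>\<open>W\<close> avoids \<open>Q (f V)\<close> but meets
      \<open>Q (f W)\<close>, so \<open>Q (f W)\<close> is not contained in
      \<open>Q (f V)\<close>.\<close>
    show "f W < f V"
    proof (rule ccontr)
      assume "\<not> f W < f V"
      then have "Q (f W) \<subseteq> Q (f V)" by (intro Q_mono) simp
      then show False using f[OF W(1)] W(2) unfolding good_def by blast
    qed
  qed

  have "d_diam d (M - \<Union> (direct_succs N (containment_order N) M)) < ennreal \<epsilon>" if M: "M \<in> N" for M
  proof -
    have MG: "M \<in> G" using M N_G by blast
    have "\<Union> (c M) = M - Q (f M)" using P[OF open_c[OF MG]] unfolding c_def by simp
    \<comment> \<open>The sets of \<open>c M\<close> cover all of \<open>M\<close> outside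
      \<open>Q (f M)\<close>, so only the part of small diameter can remain.\<close>
    then have "M - \<Union> (direct_succs N (containment_order N) M) \<subseteq> M \<inter> Q (f M)"
      using direct_succs_N[OF M] by blast
    then have "d_diam d (M - \<Union> (direct_succs N (containment_order N) M)) \<le> d_diam d (M \<inter> Q (f M))"
      by (rule d_diam_mono)
    also have "\<dots> < ennreal \<epsilon>" using f[OF MG] unfolding good_def by simp
    finally show ?thesis .
  qed
  moreover have "ordinal_index N (containment_order N) \<le> (osucc ^^ (2 * n + 2)) lam"
  proof -
    \<comment> \<open>A survivor would have rank at least \<open>osucc \<eta>\<close>, where
      \<open>Q\<close> is already empty, yet a good set meets the stage given by its rank.\<close>
    have "M \<notin> iter_deriv (non_maximal (containment_order N)) N (osucc \<eta>)" for M
    proof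
      assume M: "M \<in> iter_deriv (non_maximal (containment_order N)) N (osucc \<eta>)"
      have MN: "M \<in> N"
        using iter_deriv_subset[OF non_maximal_subset] M by (rule subsetD)
      have "osucc \<eta> \<le> f M"
        by (rule iter_deriv_non_maximal_le[OF _ M])
          (auto simp: containment_order_def intro: f_less)
      then have "Q (f M) \<subseteq> Q (osucc \<eta>)" by (rule Q_mono)
      then have "Q (f M) = {}" unfolding Q_end by simp
      then show False using f[of M] N_G MN unfolding good_def by blast
    qed
    then have "iter_deriv (non_maximal (containment_order N)) N (osucc \<eta>) = {}" by blast
    then have "ordinal_index N (containment_order N) \<le> osucc \<eta>"
      unfolding ordinal_index_def by (rule Least_le)
    also have "osucc \<eta> = (osucc ^^ Suc n) lam" using assms(9) by simp
    also have "\<dots> \<le> (osucc ^^ (2 * n + 2)) lam" by (rule funpow_osucc_mono) simp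
    finally show ?thesis .
  qed
  moreover have "finite (P K)"
  proof (rule finite_disjoint_open_cover[OF assms(3)])
    show "openin ?X V" if "V \<in> P K" for V
      using that P[OF open_K] G_open by blast
    show "{} \<notin> P K" using P[OF open_K] nonempty by blast
  qed (use P[OF open_K] in simp_all)
  then have "finite (initial_nodes N (containment_order N))"
    using initial_nodes_N by (rule finite_subset[rotated])
  moreover have "\<Union> N = K" using Union_N P[OF open_K] by simp
  moreover have "N \<subseteq> basic_clopens T r" using N_G unfolding G_def by blast
  ultimately show ?thesis
    using well_founded_tree_N by blast
qed

end
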